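(* Let $f, g \in L_a^2$, that is, $f$ and $g$ are analytic functions on the open unit disk $\mathbb{D}$ that are square integrable with respect to normalized area measure. Then the Toeplitz operators $T_f$ and $T_{\overline{g}}$ on the harmonic Bergman space $L_h^2$ commute, i.e. $$T_f T_{\overline{g}} = T_{\overline{g}} T_f \quad \text{on } L_h^2$$ (meaning that $Q\big(f\,Q(\overline{g}\,p)\big) = Q\big(\overline{g}\,Q(f\,p)\big)$ for every harmonic polynomial $p$), if and only if at least one of $f$ and $g$ is constant.
   Context: Let $\mathbb{D}$ be the open unit disk in $\mathbb{C}$ and $dA(z) = \frac{1}{\pi}\,dx\,dy$ the normalized Lebesgue area measure on $\mathbb{D}$. $L^2(\mathbb{D}, dA)$ is the Hilbert space of square integrable complex-valued functions with inner product $\langle u, v\rangle = \int_{\mathbb{D}} u\overline{v}\,dA$. The Bergman space $L_a^2$ is the closed subspace of $L^2(\mathbb{D}, dA)$ consisting of analytic functions on $\mathbb{D}$. The harmonic Bergman space $L_h^2$ is the closed subspace of $L^2(\mathbb{D}, dA)$ consisting of all complex-valued harmonic functions on $\mathbb{D}$. A harmonic polynomial is a finite complex linear combination of the functions $z^n$ and $\overline{z}^n$, $n \geq 0$; these are dense in $L_h^2$. Let $P$ and $Q$ be the orthogonal projections of $L^2(\mathbb{D}, dA)$ onto $L_a^2$ and $L_h^2$, respectively. $P$ is extended to $L^1(\mathbb{D}, dA)$ by $$(Pu)(z) = \int_{\mathbb{D}} \frac{u(w)}{(1 - z\overline{w})^2}\,dA(w), \qquad u \in L^1(\mathbb{D},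 dA),\ z \in \mathbb{D},$$ so that $Pu$ is analytic on $\mathbb{D}$, and $Q$ is extended to $L^1(\mathbb{D}, dA)$ by $$Qu = Pu + \overline{P(\overline{u})} - (Pu)(0), \qquad u \in L^1(\mathbb{D}, dA),$$ which is a (not necessarily square integrable) harmonic function on $\mathbb{D}$ and agrees with the orthogonal projection when $u \in L^2(\mathbb{D}, dA)$. For $\varphi \in L^2(\mathbb{D}, dA)$, the Toeplitz operator $T_\varphi$ on $L_h^2$ with symbol $\varphi$ is the densely defined (possibly unbounded) operator given by $T_\varphi p = Q(\varphi p)$ for harmonic polynomials $p$. For $\varphi, \psi \in L^2(\mathbb{D}, dA)$ and a harmonic polynomial $p$, the product is understood as $T_\varphi T_\psi p = Q\big(\varphi\, Q(\psi p)\big)$; here $\psi p \in L^2(\mathbb{D}, dA)$, hence $Q(\psi p) \in L_h^2$ and $\varphi\, Q(\psi p) \in L^1(\mathbb{D}, dA)$, so the outer $Q$ is the extension to $L^1(\mathbb{D}, dA)$ above. *)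

theory Defs
  imports "HOL-Analysis.Analysis"
begin

abbreviation unit_disk :: "complex set" ("\<bbbD>")
  where "\<bbbD> \<equiv> ball 0 1"

definition dA :: "complex measure"
  where "dA = density (lebesgue_on \<bbbD>) (\<lambda>_. ennreal (1 / pi))"

definition L2_disk :: "(complex \<Rightarrow> complex) set"
  where "L2_disk = {u \<in> borel_measurable dA. integrable dA (\<lambda>z. (cmod (u z))\<^sup>2)}"

text \<open>
  Elements of the function spaces are functions on the whole plane, of which only the values
  on the disk matter.
\<close>

definition bergman_space :: "(complex \<Rightarrow> complex) set"
  where "bergman_space = {f \<in> L2_disk. f holomorphic_on \<bbbD>}"

definition harmonic_polynomials :: "(complex \<Rightarrow> complex) set"
  where "harmonic_polynomials =
    {(\<lambda>z. \<Sum>k\<le>n. a k * z ^ k + b k * cnj z ^ k) | (n :: nat) a b. True}"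

text \<open>
  The projections onto the Bergman and the harmonic Bergman space, in the integral form that
  extends them from \<open>L\<^sup>2\<close> to \<open>L\<^sup>1\<close>. They are meaningful for \<open>u\<close> integrable with respect to
  \<^const>\<open>dA\<close> and \<open>z\<close> in the disk, where the kernel is bounded in \<open>w\<close>.
\<close>

definition bergman_proj :: "(complex \<Rightarrow> complex) \<Rightarrow> complex \<Rightarrow> complex"
  where "bergman_proj u z = (LINT w|dA. u w / (1 - z * cnj w)\<^sup>2)"

definition harmonic_proj :: "(complex \<Rightarrow> complex) \<Rightarrow> complex \<Rightarrow> complex"
  where "harmonic_proj u z =
    bergman_proj u z + cnj (bergman_proj (\<lambda>w. cnj (u w)) z) - bergman_proj u 0"

text \<open>
  The argument \<open>u\<close> is a harmonic polynomial or, in a product of two Toeplitz operators, the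
  square integrable harmonic function produced by the inner one; in the latter case the
  product of \<open>\<phi>\<close> and \<open>u\<close> is in general only in \<open>L\<^sup>1\<close>.
\<close>

definition toeplitz :: "(complex \<Rightarrow> complex) \<Rightarrow> (complex \<Rightarrow> complex) \<Rightarrow> complex \<Rightarrow> complex"
  where "toeplitz \<phi> u = harmonic_proj (\<lambda>w. \<phi> w * u w)"

end

theory Submission
  imports Defs "HOL-Complex_Analysis.Cauchy_Integral_Formula"
begin

text \<open>
  Write \<open>f = \<Sum> a\<^sub>m z\<^sup>m\<close> and \<open>g = \<Sum> b\<^sub>n z\<^sup>n\<close>. If one of the two is constant, one of the operators is,
  up to a scalar, the projection \<open>Q\<close>, which fixes harmonic polynomials and the square integrable
  harmonic functions that the other operator produces; so they commute
  (\<open>toeplitz_constant_commutes\<close>).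

  For the converse it is enough to test commutation on the monomials \<open>z\<^sup>k\<close> and to compare the moments
  of both sides against \<open>cnj z\<^sup>l\<close>: if \<open>Q\<close> annihilates an integrable function, all these moments
  vanish (\<open>moment_zero_if_harmonic_proj_zero\<close>). In one order \<open>T\<^sub>f z\<^sup>k = f z\<^sup>k\<close>, and the moment is the
  integral of \<open>f z\<^sup>k\<close> times the conjugate of \<open>g z\<^sup>l\<close>, given by Parseval's formula. In the other order
  the coefficients of \<open>Q(cnj g z\<^sup>k)\<close> are explicit (\<open>coeff_identity_toeplitz_product\<close>). Both moments
  are series in the products \<open>a\<^sub>m cnj b\<^sub>n\<close> with \<open>m - n = l - k\<close>. By the symmetry between \<open>f\<close> and \<open>g\<close>
  let \<open>l = k + e\<close> and \<open>x\<^sub>j = a\<^bsub>j+e\<^esub> cnj b\<^sub>j\<close>. The difference of the two series is, up to a factor,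
  \<open>\<Sum>\<^sub>j D(min j k) / (j + k + e + 1) z\<^sub>j\<close> with \<open>z\<^sub>j = x\<^sub>j / ((j + 1) (j + e + 1))\<close> and the increasing
  function \<open>D(j) = j (j + e) (j + 1) (j + e + 1)\<close>.

  So the question is whether this infinite matrix, a Schur product of a Hilbert matrix with a min
  kernel, is injective. It is formally positive definite, but square integrability of \<open>f\<close> and \<open>g\<close>
  yields only \<open>\<Sum>\<^sub>j \<bar>x\<^sub>j\<bar> / (j + e + 1) < \<infinity>\<close>, under which its quadratic form need not converge
  absolutely. Pairing the
  \<open>k\<close>-th equation with \<open>cnj z\<^sub>k / (2 k + e + 1)\<close> makes the double series absolutely convergent.
  Moreover
  \<open>1 / (2 j + e + 1) + 1 / (2 k + e + 1) = 2 (j + k + e + 1) / ((2 j + e + 1) (2 k + e + 1))\<close>,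
  so that symmetrizing cancels the Hilbert matrix and leaves the form
  \<open>\<Sum> D(min j k) v\<^sub>j cnj v\<^sub>k\<close> with \<open>v\<^sub>j = z\<^sub>j / (2 j + e + 1)\<close>. Its truncations are sums of squares of
  the tail sums of \<open>v\<close>; hence \<open>v\<^sub>j = 0\<close> for \<open>j \<ge> 1\<close> (\<open>hilbert_min_kernel_injective\<close>). Therefore
  \<open>a\<^sub>m b\<^sub>n = 0\<close> for all \<open>m, n \<ge> 1\<close>, and \<open>f\<close> or \<open>g\<close> is constant.

  All integrals are computed from the orthogonality of the monomials on disks of radius \<open>r < 1\<close>,
  where power series converge uniformly, and the passage \<open>r \<rightarrow> 1\<close>.
\<close>

section \<open>Rotation invariance of the area measure\<close>

lemma distr_lborel_orthogonal:
  fixes f :: "real^'n::{finite,wellorder} \<Rightarrow> real^'n::_"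
  assumes f: "orthogonal_transformation f"
  shows "distr lborel borel f = lborel"
proof (rule lborel_eqI[symmetric])
  have lin: "linear f" and bij: "bij f"
    using f orthogonal_transformation_linear orthogonal_transformation_bij by blast+
  then have meas: "f \<in> borel_measurable borel"
    by (intro borel_measurable_continuous_onI linear_continuous_on) (simp add: linear_linear)
  fix l u :: "real^'n::{finite,wellorder}" assume lu: "\<And>b. b \<in> Basis \<Longrightarrow> l \<bullet> b \<le> u \<bullet> b"
  have img: "f -` box l u = inv f ` box l u"
    using bij by (simp add: bij_vimage_eq_inv_image)
  have inv: "orthogonal_transformation (inv f)"
    by (rule orthogonal_transformation_inv[OF f])
  have m1: "f -` box l u \<in> lmeasurable"
    unfolding img by (rule measurable_orthogonal_image[OF inv]) simp
  have m2: "measure lebesgue (f -` box l u) = measure lebesgue (box l u)"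
    unfolding img by (rule measure_orthogonal_image[OF inv]) simp
  have b: "f -` box l u \<in> sets borel"
    using measurable_sets[OF meas, of "box l u"] by simp
  have "emeasure lebesgue (f -` box l u) = emeasure lebesgue (box l u)"
    using m1 m2 by (simp add: emeasure_eq_measure2 fmeasurableD2)
  then have "emeasure (distr lborel borel f) (box l u) = emeasure lborel (box l u)"
    using meas b by (subst emeasure_distr) (auto simp: )
  then show "emeasure (distr lborel borel f) (box l u) = (\<Prod>b\<in>Basis. (u - l) \<bullet> b)"
    using lu by (simp add: emeasure_lborel_box)
qed simp

text \<open>
  Through this identification the complex plane inherits the orthogonal invariance of Lebesgue
  measure on coordinate spaces.
\<close>

definition plane :: "real^2 \<Rightarrow> complex"
  where "plane x = Complex (x $ 1) (x $ 2)"

lemma distr_lborel_plane: "distr lborel borel plane = lborel"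
proof (rule lborel_eqI[symmetric])
  have meas: "plane \<in> borel_measurable borel"
    unfolding plane_def Complex_eq by measurable
  fix l u :: complex assume lu: "\<And>b. b \<in> Basis \<Longrightarrow> l \<bullet> b \<le> u \<bullet> b"
  let ?l = "vector [Re l, Im l] :: real^2" and ?u = "vector [Re u, Im u] :: real^2"
  have "plane -` box l u = box ?l ?u"
    by (auto simp: plane_def box_def Basis_complex_def Basis_vec_def UNIV_2 inner_axis)
  moreover have "emeasure lborel (box ?l ?u) = (\<Prod>b\<in>Basis. (u - l) \<bullet> b)"
    using lu[of 1] lu[of \<i>] by (subst emeasure_lborel_box)
      (auto simp: Basis_complex_def Basis_vec_def UNIV_2 inner_axis axis_eq_axis mult.commute)
  ultimately show "emeasure (distr lborel borel plane) (box l u) = (\<Prod>b\<in>Basis. (u - l) \<bullet> b)"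
    using meas by (simp add: emeasure_distr)
qed simp

lemma distr_lborel_rotation:
  assumes "cmod c = 1"
  shows "distr lborel borel ((*) c) = (lborel :: complex measure)"
proof -
  define rot :: "real^2 \<Rightarrow> real^2"
    where "rot x = vector [Re c * x $ 1 - Im c * x $ 2, Im c * x $ 1 + Re c * x $ 2]" for x
  have "linear rot"
    by (rule linearI) (simp_all add: rot_def vec_eq_iff forall_2 algebra_simps)
  moreover have "rot v \<bullet> rot w = v \<bullet> w" for v w
  proof -
    have "rot v \<bullet> rot w = ((Re c)\<^sup>2 + (Im c)\<^sup>2) * (v \<bullet> w)"
      by (simp add: rot_def inner_vec_def sum_2 power2_eq_square algebra_simps)
    then show ?thesis using assms by (simp add: cmod_def)
  qed
  ultimately have "orthogonal_transformation rot"
    by (simp add: orthogonal_transformation_def)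
  then have rot: "distr lborel borel rot = lborel"
    by (rule distr_lborel_orthogonal)
  have mrot: "rot \<in> borel_measurable borel"
    using \<open>linear rot\<close> by (intro borel_measurable_continuous_onI linear_continuous_on) (simp add: linear_linear)
  have mplane: "plane \<in> borel_measurable borel"
    unfolding plane_def Complex_eq by measurable
  have comm: "(*) c \<circ> plane = plane \<circ> rot"
    by (auto simp: fun_eq_iff plane_def rot_def complex_eq_iff)
  have "distr lborel borel ((*) c) = distr (distr lborel borel plane) borel ((*) c)"
    by (simp add: distr_lborel_plane)
  also have "\<dots> = distr (distr lborel borel rot) borel plane"
    using mrot mplane by (simp add: distr_distr comm)
  also have "\<dots> = lborel"
    by (simp add: rot distr_lborel_plane)
  finally show ?thesis .
qed

section \<open>Moments of monomials\<close>

lemma borel_measurable_cnj [measurable (raw)]: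
  assumes "f \<in> borel_measurable M"
  shows "(\<lambda>x. cnj (f x)) \<in> borel_measurable M"
  using measurable_compose[OF assms, of cnj borel]
  by (simp add: borel_measurable_continuous_onI continuous_on_cnj)

lemma space_dA [simp]: "space dA = \<bbbD>"
  by (simp add: dA_def)

lemma emeasure_dA:
  assumes "X \<in> sets borel" "X \<subseteq> \<bbbD>"
  shows "emeasure dA X = ennreal (1 / pi) * emeasure lborel X"
proof -
  have "emeasure dA X = (\<integral>\<^sup>+w. ennreal (1 / pi) * indicator X w \<partial>lebesgue_on \<bbbD>)"
    using assms by (simp add: dA_def emeasure_density sets_restrict_space_iff)
  also have "\<dots> = ennreal (1 / pi) * emeasure (lebesgue_on \<bbbD>) X"
    using assms by (simp add: nn_integral_cmult_indicator sets_restrict_space_iff)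
  also have "emeasure (lebesgue_on \<bbbD>) X = emeasure lborel X"
    using assms by (simp add: emeasure_restrict_space)
  finally show ?thesis .
qed

lemma borel_measurable_dA:
  assumes "f \<in> borel_measurable borel"
  shows "f \<in> borel_measurable dA"
proof -
  have "f \<in> borel_measurable lebesgue"
    using assms by (simp add: measurable_completion)
  then show ?thesis
    by (simp add: dA_def measurable_restrict_space1)
qed

lemma emeasure_dA_ball:
  assumes "0 \<le> r" "r \<le> 1"
  shows "emeasure dA (ball 0 r) = ennreal (r\<^sup>2)"
proof -
  have "emeasure dA (ball 0 r) = ennreal (1 / pi) * emeasure lborel (ball (0::complex) r)"
    using assms by (intro emeasure_dA) auto
  also have "emeasure lborel (ball (0::complex) r) = ennreal (pi * r\<^sup>2)"
    using assms by (simp add: emeasure_ball unit_ball_vol_2)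
  finally show ?thesis
    using assms by (simp flip: ennreal_mult)
qed

lemma emeasure_dA_cball:
  assumes "0 \<le> r" "r < 1"
  shows "emeasure dA (cball 0 r) = ennreal (r\<^sup>2)"
proof -
  have "emeasure dA (cball 0 r) = ennreal (1 / pi) * emeasure lborel (cball (0::complex) r)"
    using assms by (intro emeasure_dA) auto
  also have "emeasure lborel (cball (0::complex) r) = ennreal (pi * r\<^sup>2)"
    using assms by (simp add: emeasure_cball unit_ball_vol_2)
  finally show ?thesis
    using assms by (simp flip: ennreal_mult)
qed

lemma emeasure_dA_disk: "emeasure dA \<bbbD> = 1"
  using emeasure_dA_ball[of 1] by simp

lemma sets_dA: "X \<in> sets borel \<Longrightarrow> X \<subseteq> \<bbbD> \<Longrightarrow> X \<in> sets dA"
  by (simp add: dA_def sets_restrict_space_iff)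

text \<open>
  The disk of radius \<open>r\<close> has normalized area \<open>r\<^sup>2\<close>, so the square of the modulus is uniformly distributed
  on the unit interval. This replaces polar coordinates for radial integrands.
\<close>

lemma distr_dA_norm_sq:
  "distr dA borel (\<lambda>w. (cmod w)\<^sup>2) = density lborel (\<lambda>t. ennreal (indicator {0..1} t))" (is "?M = ?N")
proof (rule measure_eqI_lessThan)
  have m: "(\<lambda>w. (cmod w)\<^sup>2) \<in> borel_measurable dA"
    by (rule borel_measurable_dA) simp
  have M: "emeasure ?M {x<..} = emeasure dA {w \<in> \<bbbD>. x < (cmod w)\<^sup>2}" for x
    using m by (subst emeasure_distr) (auto intro!: arg_cong2[where f = emeasure])
  have N: "emeasure ?N {x<..} = emeasure lborel ({0..1} \<inter> {x<..})" for x :: real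
    by (simp add: emeasure_density ennreal_indicator flip: indicator_inter_arith)
  show "emeasure ?M {x<..} = emeasure ?N {x<..}" for x
  proof -
    consider "x < 0" | "0 \<le> x" "x < 1" | "1 \<le> x" by linarith
    then show ?thesis
    proof cases
      case 1
      then have "{w \<in> \<bbbD>. x < (cmod w)\<^sup>2} = \<bbbD>" "{0..1} \<inter> {x<..} = {0..1}"
        by (auto intro: less_le_trans)
      then show ?thesis by (simp add: M N emeasure_dA_disk)
    next
      case 2
      have "x < (cmod w)\<^sup>2 \<longleftrightarrow> w \<notin> cball 0 (sqrt x)" for w
        using real_sqrt_less_iff[of x "(cmod w)\<^sup>2"] by (simp add: not_le)
      then have e: "{w \<in> \<bbbD>. x < (cmod w)\<^sup>2} = \<bbbD> - cball 0 (sqrt x)" by blast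
      have s: "sqrt x < 1" using 2 by simp
      have sub: "cball 0 (sqrt x) \<subseteq> \<bbbD>"
        using s by (simp add: cball_subset_ball_iff)
      have "emeasure dA (\<bbbD> - cball 0 (sqrt x)) = emeasure dA \<bbbD> - emeasure dA (cball 0 (sqrt x))"
        using sub 2 s by (intro emeasure_Diff) (auto simp: emeasure_dA_cball intro!: sets_dA)
      also have "\<dots> = ennreal (1 - x)"
        using 2 s ennreal_minus[of x 1] by (simp add: emeasure_dA_cball emeasure_dA_disk)
      finally have "emeasure ?M {x<..} = ennreal (1 - x)"
        by (simp only: M e)
      moreover have "{0..1} \<inter> {x<..} = {x<..1}" using 2 by auto
      then have "emeasure ?N {x<..} = ennreal (1 - x)"
        using 2 by (simp add: N)
      ultimately show ?thesis by simp
    next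
      case 3
      have "\<not> x < (cmod w)\<^sup>2" if "w \<in> \<bbbD>" for w
        using 3 that power_le_one[of "cmod w" 2] by auto
      then have "{w \<in> \<bbbD>. x < (cmod w)\<^sup>2} = {}" by auto
      moreover have "{0..1} \<inter> {x<..} = {}" using 3 by auto
      ultimately show ?thesis by (simp only: M N emeasure_empty)
    qed
  qed
  show "emeasure ?M {x<..} < \<infinity>" for x
  proof -
    have "emeasure ?M {x<..} \<le> emeasure dA \<bbbD>"
      unfolding M by (rule emeasure_mono) (auto intro!: sets_dA)
    then show ?thesis by (simp add: emeasure_dA_disk le_less_trans)
  qed
qed simp_all

interpretation dA: finite_measure dA
  by (rule finite_measureI) (simp add: emeasure_dA_disk)

lemma radial_moment:
  assumes "0 \<le> r" "r < 1"
  shows "(LINT w|dA. indicator (cball 0 r) w * (w ^ n * cnj w ^ n)) = of_real (r ^ (2 * n + 2) / (n + 1))"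
proof -
  have m: "(\<lambda>w. (cmod w)\<^sup>2) \<in> borel_measurable dA"
    by (rule borel_measurable_dA) simp
  have "(LINT w|dA. indicator (cball 0 r) w * (w ^ n * cnj w ^ n)) =
        (LINT w|dA. of_real (indicator {0..r\<^sup>2} ((cmod w)\<^sup>2) * ((cmod w)\<^sup>2) ^ n))"
  proof (rule Bochner_Integration.integral_cong[OF refl])
    fix w
    have "cmod w \<le> r \<longleftrightarrow> (cmod w)\<^sup>2 \<le> r\<^sup>2"
      using assms by (simp add: power2_le_iff_abs_le)
    moreover have "w ^ n * cnj w ^ n = of_real (((cmod w)\<^sup>2) ^ n)"
      by (metis complex_norm_square of_real_power power_mult_distrib)
    ultimately show "indicator (cball 0 r) w * (w ^ n * cnj w ^ n) =
        complex_of_real (indicator {0..r\<^sup>2} ((cmod w)\<^sup>2) * ((cmod w)\<^sup>2) ^ n)"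
      by (simp add: indicator_def)
  qed
  also have "\<dots> = of_real (LINT w|dA. indicator {0..r\<^sup>2} ((cmod w)\<^sup>2) * ((cmod w)\<^sup>2) ^ n)"
    by (rule integral_complex_of_real)
  also have "(LINT w|dA. indicator {0..r\<^sup>2} ((cmod w)\<^sup>2) * ((cmod w)\<^sup>2) ^ n) =
      (LINT t|distr dA borel (\<lambda>w. (cmod w)\<^sup>2). indicator {0..r\<^sup>2} t * t ^ n)"
    using m by (subst integral_distr) auto
  also have "\<dots> = (LINT t|lborel. indicator {0..1} t *\<^sub>R (indicator {0..r\<^sup>2} t * t ^ n))"
    unfolding distr_dA_norm_sq by (subst integral_density) auto
  also have "\<dots> = (LINT t|lborel. t ^ n * indicator {0..r\<^sup>2} t)"
  proof (rule Bochner_Integration.integral_cong[OF refl])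
    fix t
    have "r\<^sup>2 \<le> 1" using assms by (simp add: power_le_one)
    then show "indicator {0..1} t *\<^sub>R (indicator {0..r\<^sup>2} t * t ^ n) = t ^ n * indicator {0..r\<^sup>2} t"
      by (auto simp: indicator_def)
  qed
  also have "\<dots> = r ^ (2 * n + 2) / (n + 1)"
  proof -
    have "(r\<^sup>2) ^ Suc n = r ^ (2 * n + 2)"
      using power_mult[of r 2 "Suc n"] by simp
    then show ?thesis
      by (subst integral_power) (auto simp: add_ac)
  qed
  finally show ?thesis .
qed

lemma integral_dA_rotation:
  fixes F :: "complex \<Rightarrow> complex"
  assumes "cmod c = 1" and F [measurable]: "F \<in> borel_measurable borel"
  shows "(LINT w|dA. F (c * w)) = (LINT w|dA. F w)"
proof -
  have meas: "(\<lambda>w. indicat_real \<bbbD> w *\<^sub>R G w) \<in> borel_measurable borel"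
    if "G \<in> borel_measurable borel" for G :: "complex \<Rightarrow> complex"
  proof -
    have "(\<lambda>w. indicat_real \<bbbD> w) \<in> borel_measurable (borel :: complex measure)"
      by (rule borel_measurable_indicator) (rule borel_open[OF open_ball])
    then show ?thesis
      using that by (rule borel_measurable_scaleR)
  qed
  have dA: "(LINT w|dA. G w) = (LINT w|lborel. indicator \<bbbD> w *\<^sub>R G w) /\<^sub>R pi"
    if [measurable]: "G \<in> borel_measurable borel" for G :: "complex \<Rightarrow> complex"
  proof -
    have "(LINT w|dA. G w) = (LINT w|lebesgue_on \<bbbD>. (1 / pi) *\<^sub>R G w)"
      unfolding dA_def using that
      by (subst integral_density) (auto intro!: measurable_restrict_space1 measurable_completion)
    also have "\<dots> = (LINT w|lebesgue_on \<bbbD>. G w) /\<^sub>R pi"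
      by (simp add: inverse_eq_divide)
    also have "(LINT w|lebesgue_on \<bbbD>. G w) = (LINT w|lebesgue. indicator \<bbbD> w *\<^sub>R G w)"
      by (subst integral_restrict_space) auto
    also have "\<dots> = (LINT w|lborel. indicator \<bbbD> w *\<^sub>R G w)"
      by (rule integral_completion) (simp add: meas that)
    finally show ?thesis .
  qed
  have "(LINT w|lborel. indicator \<bbbD> w *\<^sub>R F w) = (LINT w|distr lborel borel ((*) c). indicator \<bbbD> w *\<^sub>R F w)"
    by (simp add: distr_lborel_rotation assms)
  also have "\<dots> = (LINT w|lborel. indicator \<bbbD> (c * w) *\<^sub>R F (c * w))"
    by (rule integral_distr) (simp_all add: meas F)
  also have "\<dots> = (LINT w|lborel. indicator \<bbbD> w *\<^sub>R F (c * w))"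
    using assms by (simp add: indicator_def norm_mult)
  finally show ?thesis
    using F by (subst (1 2) dA) auto
qed

text \<open>
  For \<open>m \<noteq> n\<close> the integrand is multiplied by \<open>c\<^sup>m cnj c\<^sup>n\<close> under the rotation by a unit \<open>c\<close>,
  while the integral is unchanged.
\<close>

lemma monomial_moment:
  assumes "0 \<le> r" "r < 1"
  shows "(LINT w|dA. indicator (cball 0 r) w * (w ^ m * cnj w ^ n)) =
    (if m = n then of_real (r ^ (2 * n + 2) / (n + 1)) else 0)"
proof (cases "m = n")
  case True
  then show ?thesis using radial_moment[OF assms] by simp
next
  case False
  let ?I = "LINT w|dA. indicator (cball 0 r) w * (w ^ m * cnj w ^ n)"
  \<comment> \<open>the angle for which the factor is \<open>-1\<close>\<close>
  define c where "c = cis (pi / (real m - real n))"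
  have "(\<lambda>w. w ^ m * cnj w ^ n) \<in> borel_measurable borel"
    by (intro borel_measurable_continuous_onI continuous_intros)
  then have meas: "(\<lambda>w. indicator (cball 0 r) w * (w ^ m * cnj w ^ n)) \<in> borel_measurable borel"
    by (intro borel_measurable_times borel_measurable_indicator) auto
  have "cmod c = 1"
    by (simp add: c_def)
  from integral_dA_rotation[OF this meas]
  have "?I = (LINT w|dA. indicator (cball 0 r) (c * w) * ((c * w) ^ m * cnj (c * w) ^ n))"
    by (rule sym)
  also have "\<dots> = (LINT w|dA. (c ^ m * cnj c ^ n) * (indicator (cball 0 r) w * (w ^ m * cnj w ^ n)))"
    by (rule Bochner_Integration.integral_cong) (auto simp: c_def norm_mult indicator_def power_mult_distrib)
  also have "\<dots> = (c ^ m * cnj c ^ n) * ?I"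
    by simp
  finally have "?I = (c ^ m * cnj c ^ n) * ?I" .
  moreover have "c ^ m * cnj c ^ n = -1"
  proof -
    have "c ^ m * cnj c ^ n = cis (real m * (pi / (real m - real n)) - real n * (pi / (real m - real n)))"
      by (simp only: c_def cis_cnj Complex.DeMoivre cis_mult) (simp add: algebra_simps)
    also have "real m * (pi / (real m - real n)) - real n * (pi / (real m - real n)) = pi"
      using False by (simp only: left_diff_distrib[symmetric]) simp
    finally show ?thesis by simp
  qed
  ultimately show ?thesis using False by simp
qed

section \<open>Square integrable functions on the disk\<close>

lemma L2_disk_D:
  assumes "u \<in> L2_disk"
  shows "u \<in> borel_measurable dA" "integrable dA (\<lambda>w. (cmod (u w))\<^sup>2)"
  using assms by (auto simp: L2_disk_def)

lemma L2_disk_cong: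
  assumes "u \<in> L2_disk" "\<And>w. w \<in> \<bbbD> \<Longrightarrow> u w = v w"
  shows "v \<in> L2_disk"
proof -
  have "v \<in> borel_measurable dA"
    using measurable_cong[of dA u v borel] assms L2_disk_D(1)[OF assms(1)] by simp
  moreover have "integrable dA (\<lambda>w. (cmod (v w))\<^sup>2)"
    using Bochner_Integration.integrable_cong[of dA dA "\<lambda>w. (cmod (u w))\<^sup>2" "\<lambda>w. (cmod (v w))\<^sup>2"]
      assms L2_disk_D(2)[OF assms(1)] by simp
  ultimately show ?thesis by (simp add: L2_disk_def)
qed

lemma L2_disk_cnj: "u \<in> L2_disk \<Longrightarrow> (\<lambda>w. cnj (u w)) \<in> L2_disk"
  by (auto simp: L2_disk_def intro: borel_measurable_cnj)

lemma L2_disk_mult_bounded: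
  assumes u: "u \<in> L2_disk" and b: "b \<in> borel_measurable dA" "\<And>w. w \<in> \<bbbD> \<Longrightarrow> cmod (b w) \<le> B"
  shows "(\<lambda>w. u w * b w) \<in> L2_disk"
proof -
  note [measurable] = L2_disk_D(1)[OF u] b(1)
  have "integrable dA (\<lambda>w. (cmod (u w * b w))\<^sup>2)"
  proof (rule Bochner_Integration.integrable_bound)
    show "integrable dA (\<lambda>w. (cmod (u w))\<^sup>2 * B\<^sup>2)"
      using L2_disk_D(2)[OF u] by simp
    have "(cmod (u w * b w))\<^sup>2 \<le> (cmod (u w))\<^sup>2 * B\<^sup>2" if "w \<in> \<bbbD>" for w
      unfolding norm_mult power_mult_distrib using b(2)[OF that] by (intro mult_left_mono power_mono) auto
    then show "AE w in dA. norm ((cmod (u w * b w))\<^sup>2) \<le> norm ((cmod (u w))\<^sup>2 * B\<^sup>2)"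
      by (intro AE_I2) simp
  qed measurable
  then show ?thesis by (simp add: L2_disk_def)
qed

lemma integrable_mult_L2_disk:
  assumes u: "u \<in> L2_disk" and v: "v \<in> L2_disk"
  shows "integrable dA (\<lambda>w. u w * v w)"
proof (rule Bochner_Integration.integrable_bound)
  note [measurable] = L2_disk_D(1)[OF u] L2_disk_D(1)[OF v]
  show "integrable dA (\<lambda>w. (cmod (u w))\<^sup>2 + (cmod (v w))\<^sup>2)"
    using L2_disk_D(2)[OF u] L2_disk_D(2)[OF v] by simp
  show "(\<lambda>w. u w * v w) \<in> borel_measurable dA"
    by measurable
  have "cmod (u w * v w) \<le> (cmod (u w))\<^sup>2 + (cmod (v w))\<^sup>2" for w
  proof -
    have "2 * (cmod (u w) * cmod (v w)) \<le> (cmod (u w))\<^sup>2 + (cmod (v w))\<^sup>2"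
      using sum_squares_bound[of "cmod (u w)" "cmod (v w)"] by (simp add: mult.assoc)
    moreover have "0 \<le> cmod (u w) * cmod (v w)" by simp
    ultimately show ?thesis unfolding norm_mult by linarith
  qed
  then show "AE w in dA. norm (u w * v w) \<le> norm ((cmod (u w))\<^sup>2 + (cmod (v w))\<^sup>2)"
    by (intro AE_I2) simp
qed

lemma L2_disk_bounded:
  assumes "b \<in> borel_measurable dA" "\<And>w. w \<in> \<bbbD> \<Longrightarrow> cmod (b w) \<le> B"
  shows "b \<in> L2_disk"
proof -
  have "(\<lambda>w. 1) \<in> L2_disk" by (simp add: L2_disk_def)
  from L2_disk_mult_bounded[OF this assms] show ?thesis by simp
qed

lemma integrable_L2_disk: "u \<in> L2_disk \<Longrightarrow> integrable dA u"
  using integrable_mult_L2_disk[of u "\<lambda>_. 1"] L2_disk_bounded[of "\<lambda>_. 1" 1] by simp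

lemma integrable_mult_bounded:
  assumes "integrable dA u" "b \<in> borel_measurable dA" "\<And>w. w \<in> \<bbbD> \<Longrightarrow> cmod (b w) \<le> B"
  shows "integrable dA (\<lambda>w. u w * b w)"
proof (rule Bochner_Integration.integrable_bound)
  show "integrable dA (\<lambda>w. u w * of_real B)"
    using assms(1) by simp
  show "(\<lambda>w. u w * b w) \<in> borel_measurable dA"
    using assms(1,2) by (intro borel_measurable_times) auto
  have "cmod (u w * b w) \<le> cmod (u w * of_real B)" if "w \<in> \<bbbD>" for w
    using assms(3)[OF that] order_trans[OF norm_ge_zero assms(3)[OF that]]
    by (simp add: norm_mult mult_left_mono)
  then show "AE w in dA. norm (u w * b w) \<le> norm (u w * of_real B)"
    by (intro AE_I2) simp
qed

lemma L2_disk_add: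
  assumes u: "u \<in> L2_disk" and v: "v \<in> L2_disk"
  shows "(\<lambda>w. u w + v w) \<in> L2_disk"
proof -
  note [measurable] = L2_disk_D(1)[OF u] L2_disk_D(1)[OF v]
  have "integrable dA (\<lambda>w. (cmod (u w + v w))\<^sup>2)"
  proof (rule Bochner_Integration.integrable_bound)
    show "integrable dA (\<lambda>w. 2 * (cmod (u w))\<^sup>2 + 2 * (cmod (v w))\<^sup>2)"
      using L2_disk_D(2)[OF u] L2_disk_D(2)[OF v] by simp
    have "(cmod (u w + v w))\<^sup>2 \<le> 2 * (cmod (u w))\<^sup>2 + 2 * (cmod (v w))\<^sup>2" for w
    proof -
      have "(cmod (u w + v w))\<^sup>2 \<le> (cmod (u w) + cmod (v w))\<^sup>2"
        by (intro power_mono norm_triangle_ineq) simp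
      then show ?thesis
        using sum_squares_bound[of "cmod (u w)" "cmod (v w)"] by (simp add: power2_sum)
    qed
    then show "AE w in dA. norm ((cmod (u w + v w))\<^sup>2) \<le> norm (2 * (cmod (u w))\<^sup>2 + 2 * (cmod (v w))\<^sup>2)"
      by (intro AE_I2) simp
  qed measurable
  then show ?thesis by (simp add: L2_disk_def)
qed

lemma continuous_dA: "continuous_on UNIV f \<Longrightarrow> f \<in> borel_measurable dA"
  by (intro borel_measurable_dA borel_measurable_continuous_onI)

lemma monomial_dA [measurable]:
  "(\<lambda>w. w ^ m) \<in> borel_measurable dA" "(\<lambda>w. cnj w ^ n) \<in> borel_measurable dA"
  by (intro continuous_dA continuous_intros)+

lemma monomial_bounded:
  assumes "w \<in> \<bbbD>"
  shows "cmod (w ^ m * cnj w ^ n) \<le> 1"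
  using assms by (simp add: norm_mult norm_power mult_le_one power_le_one)

lemma integrable_mult_monomial:
  assumes "integrable dA u"
  shows "integrable dA (\<lambda>w. u w * (w ^ m * cnj w ^ n))"
  using assms by (rule integrable_mult_bounded[where B = 1]) (auto intro!: monomial_bounded)

lemma L2_disk_mult_monomial:
  assumes "u \<in> L2_disk"
  shows "(\<lambda>w. u w * (w ^ m * cnj w ^ n)) \<in> L2_disk"
  using assms by (rule L2_disk_mult_bounded[where B = 1]) (auto intro!: monomial_bounded)

lemma indicator_cball_dA [measurable]: "(\<lambda>w. indicator (cball 0 r) w :: complex) \<in> borel_measurable dA"
  by (intro borel_measurable_dA borel_measurable_indicator) simp

lemma integrable_indicator_mult:
  fixes u :: "complex \<Rightarrow> complex"
  assumes "integrable dA u"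
  shows "integrable dA (\<lambda>w. indicator (cball 0 r) w * u w)"
  using integrable_mult_bounded[OF assms indicator_cball_dA[of r], of 1]
  by (simp add: indicator_def mult.commute)

text \<open>A concrete sequence increasing to \<open>1\<close>: the closed disks of these radii exhaust the open unit disk.\<close>

definition rad :: "nat \<Rightarrow> real"
  where "rad m = 1 - 1 / (m + 2)"

lemma rad: "0 \<le> rad m" "rad m < 1" "rad \<longlonglongrightarrow> 1"
proof -
  have "(\<lambda>m. 1 - inverse (real (m + 2))) \<longlonglongrightarrow> 1 - 0"
    by (intro tendsto_diff tendsto_const LIMSEQ_ignore_initial_segment lim_inverse_n)
  then show "rad \<longlonglongrightarrow> 1"
    unfolding rad_def by (simp add: inverse_eq_divide add.commute)
qed (auto simp: rad_def)

lemma eventually_in_cball_rad: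
  assumes "w \<in> \<bbbD>"
  shows "\<forall>\<^sub>F m in sequentially. w \<in> cball 0 (rad m)"
proof -
  have "\<forall>\<^sub>F m in sequentially. cmod w < rad m"
    using assms rad(3) by (intro order_tendstoD(1)) auto
  then show ?thesis by eventually_elim simp
qed

lemma integral_exhaustion:
  fixes u :: "complex \<Rightarrow> complex"
  assumes "integrable dA u"
  shows "(\<lambda>m. LINT w|dA. indicator (cball 0 (rad m)) w * u w) \<longlonglongrightarrow> (LINT w|dA. u w)"
proof (rule integral_dominated_convergence[where w = "\<lambda>w. cmod (u w)"])
  show "AE w in dA. (\<lambda>m. indicator (cball 0 (rad m)) w * u w) \<longlonglongrightarrow> u w"
  proof (rule AE_I2)
    fix w assume "w \<in> space dA"
    then have "w \<in> \<bbbD>" by simp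
    from eventually_in_cball_rad[OF this]
    have "\<forall>\<^sub>F m in sequentially. indicator (cball 0 (rad m)) w * u w = u w"
      by eventually_elim simp
    then show "(\<lambda>m. indicator (cball 0 (rad m)) w * u w) \<longlonglongrightarrow> u w"
      by (rule tendsto_eventually)
  qed
  show "AE w in dA. norm (indicator (cball 0 (rad m)) w * u w) \<le> cmod (u w)" for m
    by (intro AE_I2) (simp add: indicator_def norm_mult)
  show "(\<lambda>w. indicator (cball 0 (rad m)) w * u w) \<in> borel_measurable dA" for m
    using integrable_indicator_mult[OF assms] by (rule borel_measurable_integrable)
qed (use assms in auto)

section \<open>Power series on the disk\<close>

text \<open>
  Analyticity is used in the form of an expansion on the disk. The coefficients are a parameter
  because the functions produced by the projections come with theirs, computed as moments.
\<close>

definition expands :: "(complex \<Rightarrow> complex) \<Rightarrow> (nat \<Rightarrow> complex) \<Rightarrow> bool"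
  where "expands F A \<longleftrightarrow> (\<forall>w\<in>\<bbbD>. (\<lambda>n. A n * w ^ n) sums F w)"

lemma expandsD: "expands F A \<Longrightarrow> w \<in> \<bbbD> \<Longrightarrow> (\<lambda>n. A n * w ^ n) sums F w"
  by (simp add: expands_def)

lemma expands_measurable: "expands F A \<Longrightarrow> F \<in> borel_measurable dA"
  by (rule borel_measurable_LIMSEQ_metric[where f = "\<lambda>N w. \<Sum>n<N. A n * w ^ n"])
    (auto simp: expands_def sums_def)

lemma expands_summable:
  assumes "expands F A" "0 \<le> r" "r < 1"
  shows "summable (\<lambda>n. cmod (A n) * r ^ n)"
proof -
  obtain s where s: "r < s" "s < 1" using dense[OF assms(3)] by blast
  then have "(\<lambda>n. A n * of_real s ^ n) sums F (of_real s)"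
    using assms by (intro expandsD[OF assms(1)]) simp
  then have "summable (\<lambda>n. norm (A n * of_real r ^ n))"
    using s assms by (intro powser_insidea[of A "of_real s"]) (auto simp: sums_iff)
  then show ?thesis
    using assms by (simp add: norm_mult norm_power)
qed

text \<open>
  On the closed disk of radius \<open>r < 1\<close> the series is dominated by \<open>\<Sum> \<bar>A\<^sub>n\<bar> r\<^sup>n\<close>, so it may be integrated
  termwise against any integrable function.
\<close>

lemma disk_integral_sums:
  assumes F: "expands F A" and r: "0 \<le> r" "r < 1" and K: "integrable dA K"
  shows "integrable dA (\<lambda>w. indicator (cball 0 r) w * (F w * K w))"
    and "(\<lambda>n. A n * (LINT w|dA. indicator (cball 0 r) w * (w ^ n * K w))) sums
      (LINT w|dA. indicator (cball 0 r) w * (F w * K w))"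
proof -
  define s where "s n w = A n * (indicator (cball 0 r) w * (w ^ n * K w))" for n w
  have int0: "integrable dA (\<lambda>w. indicator (cball 0 r) w * (w ^ n * K w))" for n
    using integrable_indicator_mult[OF integrable_mult_monomial[OF K, of n 0], of r]
    by (simp add: mult.commute)
  then have int: "integrable dA (s n)" for n
    unfolding s_def by simp
  have bound: "cmod (s n w) \<le> cmod (A n) * r ^ n * cmod (K w)" for n w
  proof -
    have "cmod w ^ n * cmod (K w) \<le> r ^ n * cmod (K w)" if "cmod w \<le> r"
      using that by (intro mult_right_mono power_mono) auto
    then show ?thesis
      using r by (auto simp: s_def norm_mult norm_power indicator_def mult.assoc intro!: mult_left_mono)
  qed
  have sm: "summable (\<lambda>n. cmod (A n) * r ^ n * c)" for c
    by (intro summable_mult2 expands_summable[OF F r])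
  have AE: "AE w in dA. summable (\<lambda>n. norm (s n w))"
    by (intro AE_I2 summable_comparison_test[OF _ sm]) (use bound in auto)
  have sm': "summable (\<lambda>n. LINT w|dA. norm (s n w))"
  proof (rule summable_comparison_test[OF _ sm[of "LINT w|dA. cmod (K w)"]])
    have "(LINT w|dA. norm (s n w)) \<le> (LINT w|dA. cmod (A n) * r ^ n * cmod (K w))" for n
      using int K bound by (intro integral_mono) auto
    then show "\<exists>N. \<forall>n\<ge>N. norm (LINT w|dA. norm (s n w)) \<le> cmod (A n) * r ^ n * (LINT w|dA. cmod (K w))"
      by auto
  qed
  have S: "(\<Sum>n. s n w) = indicator (cball 0 r) w * (F w * K w)" if "w \<in> space dA" for w
  proof -
    have "(\<lambda>n. A n * w ^ n * (indicator (cball 0 r) w * K w)) sums (F w * (indicator (cball 0 r) w * K w))"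
      using that by (intro sums_mult2 expandsD[OF F]) simp
    then have "(\<lambda>n. s n w) sums (indicator (cball 0 r) w * (F w * K w))"
      by (simp add: s_def mult_ac)
    then show ?thesis by (rule sums_unique[symmetric])
  qed
  show "integrable dA (\<lambda>w. indicator (cball 0 r) w * (F w * K w))"
  proof -
    have "integrable dA (\<lambda>w. \<Sum>n. s n w) = integrable dA (\<lambda>w. indicator (cball 0 r) w * (F w * K w))"
      by (rule Bochner_Integration.integrable_cong[OF refl]) (rule S)
    then show ?thesis using integrable_suminf[OF int AE sm'] by simp
  qed
  have "(\<lambda>n. LINT w|dA. s n w) sums (LINT w|dA. indicator (cball 0 r) w * (F w * K w))"
  proof -
    have "(LINT w|dA. (\<Sum>n. s n w)) = (LINT w|dA. indicator (cball 0 r) w * (F w * K w))"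
      by (rule Bochner_Integration.integral_cong[OF refl]) (rule S)
    then show ?thesis using sums_integral[OF int AE sm'] by simp
  qed
  then show "(\<lambda>n. A n * (LINT w|dA. indicator (cball 0 r) w * (w ^ n * K w))) sums
      (LINT w|dA. indicator (cball 0 r) w * (F w * K w))"
    by (simp add: s_def)
qed

lemma disk_moment:
  assumes F: "expands F A" and r: "0 \<le> r" "r < 1"
  shows "(LINT w|dA. indicator (cball 0 r) w * (F w * (w ^ j * cnj w ^ n))) =
    (if j \<le> n then A (n - j) * of_real (r ^ (2 * n + 2) / (n + 1)) else 0)"
proof -
  have K: "integrable dA (\<lambda>w. w ^ j * cnj w ^ n)"
    using integrable_mult_monomial[of "\<lambda>_. 1" j n] by simp
  have "(\<lambda>i. A i * (LINT w|dA. indicator (cball 0 r) w * (w ^ i * (w ^ j * cnj w ^ n)))) sums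
      (LINT w|dA. indicator (cball 0 r) w * (F w * (w ^ j * cnj w ^ n)))"
    by (rule disk_integral_sums(2)[OF F r K])
  also have "(\<lambda>i. A i * (LINT w|dA. indicator (cball 0 r) w * (w ^ i * (w ^ j * cnj w ^ n)))) =
      (\<lambda>i. if i + j = n then A i * of_real (r ^ (2 * n + 2) / (n + 1)) else 0)"
    using monomial_moment[OF r] by (auto simp: fun_eq_iff mult.assoc[symmetric] power_add[symmetric] simp del: of_real_divide)
  also have "\<dots> = (\<lambda>i. if i = n - j then (if j \<le> n then A (n - j) * of_real (r ^ (2 * n + 2) / (n + 1)) else 0) else 0)"
    by (auto simp: fun_eq_iff)
  finally show ?thesis
    using sums_single[of "n - j" "\<lambda>_. if j \<le> n then A (n - j) * of_real (r ^ (2 * n + 2) / (n + 1)) else 0"]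
    by (rule sums_unique2)
qed

lemma rad_power_tendsto:
  "(\<lambda>m. c * complex_of_real (rad m ^ k / n)) \<longlonglongrightarrow> c * of_real (1 / n)"
proof -
  have "(\<lambda>m. rad m ^ k / n) \<longlonglongrightarrow> 1 ^ k / n"
    unfolding divide_inverse by (intro tendsto_mult tendsto_power tendsto_const rad)
  then have "(\<lambda>m. rad m ^ k / n) \<longlonglongrightarrow> 1 / n"
    by (simp only: power_one)
  then show ?thesis
    by (intro tendsto_mult tendsto_const tendsto_of_real)
qed

text \<open>
  The factor \<open>w\<^sup>j\<close> shifts coefficients, so that products with monomials need no expansions of
  their own.
\<close>

lemma expands_moment:
  assumes F: "expands F A" and int: "integrable dA F"
  shows "(LINT w|dA. F w * (w ^ j * cnj w ^ n)) = (if j \<le> n then A (n - j) / (n + 1) else 0)"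
proof (rule LIMSEQ_unique)
  show "(\<lambda>m. LINT w|dA. indicator (cball 0 (rad m)) w * (F w * (w ^ j * cnj w ^ n)))
      \<longlonglongrightarrow> (LINT w|dA. F w * (w ^ j * cnj w ^ n))"
    by (intro integral_exhaustion integrable_mult_monomial int)
  show "(\<lambda>m. LINT w|dA. indicator (cball 0 (rad m)) w * (F w * (w ^ j * cnj w ^ n)))
      \<longlonglongrightarrow> (if j \<le> n then A (n - j) / (n + 1) else 0)"
    using rad_power_tendsto[of "A (n - j)" "2 * n + 2" "n + 1"]
    by (simp add: disk_moment[OF F rad(1,2)])
qed

section \<open>Coefficients of square integrable functions\<close>

lemma disk_parseval:
  assumes F: "expands F A" and G: "expands G B" and r: "0 \<le> r" "r < 1"
  shows "(\<lambda>i. A (i + e) * cnj (B i) * of_real (r ^ (2 * (i + k + e) + 2) / (i + k + e + 1))) sums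
    (LINT w|dA. indicator (cball 0 r) w * (F w * w ^ k * cnj (G w * w ^ (k + e))))"
proof -
  let ?D = "\<lambda>w. indicator (cball 0 r) w :: complex"
  define K where "K w = cnj (?D w * (F w * w ^ k)) * w ^ (k + e)" for w
  have "integrable dA (\<lambda>w. w ^ k * cnj w ^ 0)"
    using integrable_mult_monomial[of "\<lambda>_. 1" k 0] by simp
  from integrable_cnj[OF disk_integral_sums(1)[OF F r this]]
  have "integrable dA (\<lambda>w. cnj (?D w * (F w * w ^ k)))"
    by (simp only: power_0 mult_1_right)
  from integrable_mult_monomial[OF this, of "k + e" 0]
  have K: "integrable dA K"
    by (simp add: K_def[abs_def])
  have "(\<lambda>i. B i * (LINT w|dA. ?D w * (w ^ i * K w))) sums (LINT w|dA. ?D w * (G w * K w))"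
    by (rule disk_integral_sums(2)[OF G r K])
  then have "(\<lambda>i. cnj (B i * (LINT w|dA. ?D w * (w ^ i * K w)))) sums cnj (LINT w|dA. ?D w * (G w * K w))"
    by (simp only: sums_cnj)
  also have "(\<lambda>i. cnj (B i * (LINT w|dA. ?D w * (w ^ i * K w)))) =
      (\<lambda>i. A (i + e) * cnj (B i) * of_real (r ^ (2 * (i + k + e) + 2) / (i + k + e + 1)))"
  proof
    fix i
    have "cnj (LINT w|dA. ?D w * (w ^ i * K w)) = (LINT w|dA. cnj (?D w * (w ^ i * K w)))"
      by (rule Bochner_Integration.integral_cnj[symmetric])
    also have "\<dots> = (LINT w|dA. ?D w * (F w * (w ^ k * cnj w ^ (i + k + e))))"
      by (rule Bochner_Integration.integral_cong) (auto simp: K_def indicator_def power_add mult_ac)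
    also have "\<dots> = A (i + e) * of_real (r ^ (2 * (i + k + e) + 2) / (i + k + e + 1))"
    proof -
      have "i + k + e - k = i + e" by simp
      then show ?thesis by (simp only: disk_moment[OF F r]) simp
    qed
    finally show "cnj (B i * (LINT w|dA. ?D w * (w ^ i * K w))) =
        A (i + e) * cnj (B i) * of_real (r ^ (2 * (i + k + e) + 2) / (i + k + e + 1))"
      by (simp only: complex_cnj_mult mult_ac)
  qed
  also have "cnj (LINT w|dA. ?D w * (G w * K w)) = (LINT w|dA. cnj (?D w * (G w * K w)))"
    by (rule Bochner_Integration.integral_cnj[symmetric])
  also have "\<dots> = (LINT w|dA. ?D w * (F w * w ^ k * cnj (G w * w ^ (k + e))))"
    by (rule Bochner_Integration.integral_cong) (auto simp: K_def indicator_def mult_ac)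
  finally show ?thesis .
qed

text \<open>
  By Parseval's formula the integrals of \<open>\<bar>F\<bar>\<^sup>2\<close> over the smaller disks are bounded by the given sum,
  and monotone convergence passes to the whole disk.
\<close>

lemma L2_disk_if_coeffs:
  assumes F: "expands F A" and A: "summable (\<lambda>n. (cmod (A n))\<^sup>2 / real (n + 1))"
  shows "F \<in> L2_disk"
proof -
  define I where "I m = (LINT w|dA. indicator (cball 0 (rad m)) w * (cmod (F w))\<^sup>2)" for m
  have meas: "F \<in> borel_measurable dA"
    using F by (rule expands_measurable)
  have eq: "indicator (cball 0 r) w * (F w * cnj (F w)) = of_real (indicator (cball 0 r) w * (cmod (F w))\<^sup>2)"
    for r w by (simp add: complex_norm_square indicator_def del: of_real_power)
  have int: "integrable dA (\<lambda>w. indicator (cball 0 (rad m)) w * (cmod (F w))\<^sup>2)" for m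
  proof -
    have "integrable dA (\<lambda>w. indicator (cball 0 (rad m)) w * (F w * 1))"
      using disk_integral_sums(1)[OF F rad(1,2), of "\<lambda>_. 1"] by simp
    from integrable_cnj[OF this]
    have "integrable dA (\<lambda>w. cnj (indicator (cball 0 (rad m)) w * F w))"
      by (simp only: mult_1_right)
    from disk_integral_sums(1)[OF F rad(1,2) this]
    have "integrable dA (\<lambda>w. indicator (cball 0 (rad m)) w * (F w * cnj (indicator (cball 0 (rad m)) w * F w)))" .
    also have "(\<lambda>w. indicator (cball 0 (rad m)) w * (F w * cnj (indicator (cball 0 (rad m)) w * F w))) =
        (\<lambda>w. complex_of_real (indicator (cball 0 (rad m)) w * (cmod (F w))\<^sup>2))"
      by (auto simp: fun_eq_iff indicator_def complex_norm_square simp del: of_real_power)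
    finally show ?thesis
      by (simp only: complex_of_real_integrable_eq)
  qed
  have "I m \<le> (\<Sum>n. (cmod (A n))\<^sup>2 / real (n + 1))" for m
  proof -
    have "(\<lambda>i. A (i + 0) * cnj (A i) * of_real (rad m ^ (2 * (i + 0 + 0) + 2) / (i + 0 + 0 + 1))) sums
        (LINT w|dA. indicator (cball 0 (rad m)) w * (F w * w ^ 0 * cnj (F w * w ^ (0 + 0))))"
      by (rule disk_parseval[OF F F rad(1,2)])
    also have "(LINT w|dA. indicator (cball 0 (rad m)) w * (F w * w ^ 0 * cnj (F w * w ^ (0 + 0)))) = of_real (I m)"
      by (simp only: power_0 mult_1_right add_0_right eq integral_complex_of_real I_def)
    also have "(\<lambda>i. A (i + 0) * cnj (A i) * of_real (rad m ^ (2 * (i + 0 + 0) + 2) / (i + 0 + 0 + 1))) =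
        (\<lambda>i. complex_of_real ((cmod (A i))\<^sup>2 / (i + 1) * rad m ^ (2 * i + 2)))"
      by (simp add: complex_norm_square[symmetric] fun_eq_iff flip: of_real_power)
    finally have sums: "(\<lambda>i. (cmod (A i))\<^sup>2 / (i + 1) * rad m ^ (2 * i + 2)) sums I m"
      by (simp only: sums_of_real_iff)
    show ?thesis
    proof (rule sums_le[OF _ sums summable_sums[OF A]])
      fix i
      have "rad m ^ (2 * i + 2) \<le> 1"
        using rad(1,2)[of m] by (intro power_le_one) auto
      then show "(cmod (A i))\<^sup>2 / (i + 1) * rad m ^ (2 * i + 2) \<le> (cmod (A i))\<^sup>2 / (i + 1)"
        by (intro mult_right_le_one_le) (use rad(1)[of m] in auto)
    qed
  qed
  moreover have mono: "indicator (cball 0 (rad m)) w * (cmod (F w))\<^sup>2 \<le> indicator (cball 0 (rad n)) w * (cmod (F w))\<^sup>2"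
    if "m \<le> n" for m n w
  proof -
    have "rad m \<le> rad n" using that by (simp add: rad_def frac_le)
    then show ?thesis by (auto simp: indicator_def)
  qed
  then have "incseq I"
    unfolding I_def by (intro incseq_SucI integral_mono int) auto
  ultimately obtain L where L: "I \<longlonglongrightarrow> L"
    using incseq_convergent[of I] by blast
  have "integrable dA (\<lambda>w. (cmod (F w))\<^sup>2)"
  proof (rule integrable_monotone_convergence[OF int])
    show "AE w in dA. mono (\<lambda>m. indicator (cball 0 (rad m)) w * (cmod (F w))\<^sup>2)"
      using mono by (intro AE_I2 monoI) auto
    show "AE w in dA. (\<lambda>m. indicator (cball 0 (rad m)) w * (cmod (F w))\<^sup>2) \<longlonglongrightarrow> (cmod (F w))\<^sup>2"
    proof (rule AE_I2)
      fix w assume "w \<in> space dA"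
      then have "w \<in> \<bbbD>" by simp
      from eventually_in_cball_rad[OF this]
      have "\<forall>\<^sub>F m in sequentially. indicator (cball 0 (rad m)) w * (cmod (F w))\<^sup>2 = (cmod (F w))\<^sup>2"
        by eventually_elim simp
      then show "(\<lambda>m. indicator (cball 0 (rad m)) w * (cmod (F w))\<^sup>2) \<longlonglongrightarrow> (cmod (F w))\<^sup>2"
        by (rule tendsto_eventually)
    qed
    show "(\<lambda>m. LINT w|dA. indicator (cball 0 (rad m)) w * (cmod (F w))\<^sup>2) \<longlonglongrightarrow> L"
      using L unfolding I_def[abs_def] .
    show "(\<lambda>w. (cmod (F w))\<^sup>2) \<in> borel_measurable dA"
      using meas by measurable
  qed
  then show ?thesis
    using meas by (simp add: L2_disk_def)
qed

definition moment :: "(complex \<Rightarrow> complex) \<Rightarrow> nat \<Rightarrow> complex"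
  where "moment u j = (LINT w|dA. u w * cnj w ^ j)"

lemma expands_polynomial:
  "expands (\<lambda>w. \<Sum>j<N. c j * w ^ j) (\<lambda>j. if j < N then c j else 0)"
  unfolding expands_def
proof
  fix w
  have "(\<lambda>j. (if j < N then c j else 0) * w ^ j) sums (\<Sum>j<N. (if j < N then c j else 0) * w ^ j)"
    by (rule sums_finite) auto
  then show "(\<lambda>j. (if j < N then c j else 0) * w ^ j) sums (\<Sum>j<N. c j * w ^ j)"
    by simp
qed

lemma L2_disk_polynomial: "(\<lambda>w. \<Sum>j<N. c j * w ^ j) \<in> L2_disk"
  by (rule L2_disk_if_coeffs[OF expands_polynomial])
    (rule summable_finite[of "{..<N}"], auto)

lemma moment_expands:
  assumes "expands F A" "integrable dA F"
  shows "moment F j = A j / of_nat (j + 1)"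
  using expands_moment[OF assms, of 0 j] by (simp add: moment_def)

lemma integrable_moment: "integrable dA u \<Longrightarrow> integrable dA (\<lambda>w. u w * cnj w ^ j)"
  using integrable_mult_monomial[of u 0 j] by simp

lemma moment_diff:
  assumes "integrable dA u" "integrable dA v"
  shows "moment (\<lambda>w. u w - v w) j = moment u j - moment v j"
  using integrable_moment[OF assms(1)] integrable_moment[OF assms(2)]
  by (simp add: moment_def left_diff_distrib)

lemma integral_mult_cnj_polynomial:
  assumes "integrable dA v"
  shows "(LINT w|dA. v w * cnj (\<Sum>j<N. c j * w ^ j)) = (\<Sum>j<N. cnj (c j) * moment v j)"
proof -
  have "(LINT w|dA. v w * cnj (\<Sum>j<N. c j * w ^ j)) = (LINT w|dA. (\<Sum>j<N. cnj (c j) * (v w * cnj w ^ j)))"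
    by (simp add: sum_distrib_left mult_ac)
  also have "\<dots> = (\<Sum>j<N. LINT w|dA. cnj (c j) * (v w * cnj w ^ j))"
    by (rule Bochner_Integration.integral_sum) (use integrable_moment[OF assms] in simp)
  finally show ?thesis
    by (simp add: moment_def)
qed

text \<open>
  Bessel's inequality for the orthogonal system of monomials, whose squared norms are
  \<open>1 / (j + 1)\<close>.
\<close>

lemma bessel_disk:
  assumes u: "u \<in> L2_disk"
  shows "summable (\<lambda>j. real (j + 1) * (cmod (moment u j))\<^sup>2)"
proof (rule summableI_nonneg_bounded)
  fix N
  \<comment> \<open>\<open>S\<close> is the orthogonal projection of \<open>u\<close> to the polynomials of degree less than \<open>N\<close>\<close>
  define c where "c j = of_nat (j + 1) * moment u j" for j
  define S where "S w = (\<Sum>j<N. c j * w ^ j)" for w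
  define b where "b = (\<Sum>j<N. real (j + 1) * (cmod (moment u j))\<^sup>2)"
  have S: "S \<in> L2_disk"
    unfolding S_def[abs_def] by (rule L2_disk_polynomial)
  define v where "v w = u w - S w" for w
  have int: "integrable dA u" "integrable dA S"
    using u S by (simp_all add: integrable_L2_disk)
  have v: "v \<in> L2_disk"
    using L2_disk_add[OF u L2_disk_mult_bounded[OF S, of "\<lambda>_. -1" 1]] by (simp add: v_def[abs_def])
  have mom0: "moment v j = 0" if "j < N" for j
  proof -
    have "moment S j = c j / of_nat (j + 1)"
      using moment_expands[OF _ int(2), of "\<lambda>j. if j < N then c j else 0" j] that expands_polynomial[of c N]
      by (simp add: S_def[abs_def])
    also have "\<dots> = moment u j"
      unfolding c_def by (simp del: of_nat_add of_nat_Suc)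
    finally show ?thesis
      using moment_diff[OF int] by (simp add: v_def[abs_def])
  qed
  have "(LINT w|dA. v w * cnj (S w)) = 0"
    unfolding S_def by (subst integral_mult_cnj_polynomial) (use mom0 integrable_L2_disk[OF v] in auto)
  moreover have "(LINT w|dA. u w * cnj (S w)) = of_real b"
  proof -
    have "cnj (c j) * moment u j = of_real (real (j + 1) * (cmod (moment u j))\<^sup>2)" for j
      unfolding of_real_mult complex_norm_square by (simp add: c_def mult_ac)
    then show ?thesis
      unfolding S_def b_def of_real_sum integral_mult_cnj_polynomial[OF int(1)] by (intro sum.cong refl)
  qed
  moreover have "(LINT w|dA. S w * cnj (u w)) = cnj (LINT w|dA. u w * cnj (S w))"
    by (subst Bochner_Integration.integral_cnj[symmetric]) (simp add: mult.commute)
  moreover have "(LINT w|dA. v w * cnj (v w)) =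
      (LINT w|dA. u w * cnj (u w)) - (LINT w|dA. S w * cnj (u w)) - (LINT w|dA. v w * cnj (S w))"
  proof -
    note i = integrable_mult_L2_disk[OF u L2_disk_cnj[OF u]] integrable_mult_L2_disk[OF S L2_disk_cnj[OF u]]
      integrable_mult_L2_disk[OF v L2_disk_cnj[OF S]]
    have "(LINT w|dA. v w * cnj (v w)) =
        (LINT w|dA. u w * cnj (u w) - S w * cnj (u w) - v w * cnj (S w))"
      by (simp add: v_def algebra_simps)
    also have "\<dots> = (LINT w|dA. u w * cnj (u w)) - (LINT w|dA. S w * cnj (u w)) - (LINT w|dA. v w * cnj (S w))"
      using i by simp
    finally show ?thesis .
  qed
  moreover have "(LINT w|dA. x w * cnj (x w)) = of_real (LINT w|dA. (cmod (x w))\<^sup>2)" for x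
    by (simp only: complex_norm_square[symmetric] integral_complex_of_real)
  ultimately have "complex_of_real (LINT w|dA. (cmod (v w))\<^sup>2) = of_real ((LINT w|dA. (cmod (u w))\<^sup>2) - b)"
    by simp
  then have "(LINT w|dA. (cmod (v w))\<^sup>2) = (LINT w|dA. (cmod (u w))\<^sup>2) - b"
    by (simp only: of_real_eq_iff)
  moreover have "0 \<le> (LINT w|dA. (cmod (v w))\<^sup>2)"
    by (rule Bochner_Integration.integral_nonneg) simp
  ultimately show "(\<Sum>j<N. real (j + 1) * (cmod (moment u j))\<^sup>2) \<le> (LINT w|dA. (cmod (u w))\<^sup>2)"
    by (simp add: b_def)
qed simp

lemma coeffs_summable:
  assumes F: "expands F A" and L2: "F \<in> L2_disk"
  shows "summable (\<lambda>n. (cmod (A n))\<^sup>2 / real (n + 1))"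
proof -
  have "real (n + 1) * (cmod (moment F n))\<^sup>2 = (cmod (A n))\<^sup>2 / real (n + 1)" for n
  proof -
    have "1 + real n \<noteq> 0" by linarith
    then show ?thesis
      unfolding moment_expands[OF F integrable_L2_disk[OF L2]] norm_divide power_divide norm_of_nat
      by (simp add: power2_eq_square add.commute)
  qed
  then show ?thesis
    using bessel_disk[OF L2] by (simp only:)
qed

lemma coeffs_product_summable:
  assumes F: "expands F A" "F \<in> L2_disk" and G: "expands G B" "G \<in> L2_disk"
  shows "summable (\<lambda>i. cmod (A (i + e) * cnj (B i)) / (i + e + 1))"
proof (rule summable_comparison_test)
  show "summable (\<lambda>i. (cmod (A (i + e)))\<^sup>2 / (i + e + 1) + (cmod (B i))\<^sup>2 / (i + 1))"
    using summable_ignore_initial_segment[OF coeffs_summable[OF F], of e]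
    by (intro summable_add coeffs_summable[OF G]) simp
  have "cmod (A (i + e) * cnj (B i)) / (i + e + 1) \<le> (cmod (A (i + e)))\<^sup>2 / (i + e + 1) + (cmod (B i))\<^sup>2 / (i + 1)" for i
  proof -
    have "cmod (A (i + e)) * cmod (B i) \<le> (cmod (A (i + e)))\<^sup>2 + (cmod (B i))\<^sup>2"
    proof -
      have "2 * (cmod (A (i + e)) * cmod (B i)) \<le> (cmod (A (i + e)))\<^sup>2 + (cmod (B i))\<^sup>2"
        using sum_squares_bound[of "cmod (A (i + e))" "cmod (B i)"] by (simp add: mult.assoc)
      moreover have "0 \<le> cmod (A (i + e)) * cmod (B i)" by simp
      ultimately show ?thesis by linarith
    qed
    then have "cmod (A (i + e) * cnj (B i)) / (i + e + 1) \<le> ((cmod (A (i + e)))\<^sup>2 + (cmod (B i))\<^sup>2) / (i + e + 1)"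
      unfolding norm_mult complex_mod_cnj by (rule divide_right_mono) simp
    also have "\<dots> = (cmod (A (i + e)))\<^sup>2 / (i + e + 1) + (cmod (B i))\<^sup>2 / (i + e + 1)"
      by (rule add_divide_distrib)
    also have "(cmod (B i))\<^sup>2 / (i + e + 1) \<le> (cmod (B i))\<^sup>2 / (i + 1)"
      by (rule divide_left_mono) auto
    finally show ?thesis by simp
  qed
  then show "\<exists>N. \<forall>i\<ge>N. norm (cmod (A (i + e) * cnj (B i)) / (i + e + 1)) \<le>
      (cmod (A (i + e)))\<^sup>2 / (i + e + 1) + (cmod (B i))\<^sup>2 / (i + 1)"
    by auto
qed

text \<open>
  The limit \<open>r \<rightarrow> 1\<close> in the formula on smaller disks: dominated convergence on the side of the
  integral, Tannery's theorem on the side of the series. Only \<open>G\<close> is multiplied by the higher power;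
  the opposite case is the complex conjugate.
\<close>

lemma parseval:
  assumes F: "expands F A" "F \<in> L2_disk" and G: "expands G B" "G \<in> L2_disk"
  shows "(\<lambda>i. A (i + e) * cnj (B i) / (i + k + e + 1)) sums (LINT w|dA. F w * w ^ k * cnj (G w * w ^ (k + e)))"
proof -
  let ?H = "\<lambda>w. F w * w ^ k * cnj (G w * w ^ (k + e))"
  define a where "a i m = A (i + e) * cnj (B i) * of_real (rad m ^ (2 * (i + k + e) + 2) / (i + k + e + 1))" for i m
  define b where "b i = A (i + e) * cnj (B i) * of_real (1 / (i + k + e + 1))" for i
  define M where "M i = cmod (A (i + e) * cnj (B i)) / (i + e + 1)" for i
  have le: "cmod (a i m) \<le> M i" for i m
  proof -
    have "rad m ^ (2 * (i + k + e) + 2) \<le> 1"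
      using rad(1,2)[of m] by (intro power_le_one) auto
    then have "rad m ^ (2 * (i + k + e) + 2) / (i + k + e + 1) \<le> 1 / (i + e + 1)"
      by (intro frac_le) auto
    moreover have "0 \<le> rad m ^ (2 * (i + k + e) + 2) / (i + k + e + 1)"
      using rad(1)[of m] by simp
    ultimately have "cmod (a i m) \<le> cmod (A (i + e) * cnj (B i)) * (1 / (i + e + 1))"
      unfolding a_def norm_mult norm_of_real by (intro mult_left_mono) auto
    then show ?thesis by (simp add: M_def)
  qed
  have lim: "a i \<longlonglongrightarrow> b i" for i
    unfolding a_def b_def by (rule rad_power_tendsto)
  have M: "summable M"
    unfolding M_def[abs_def] by (rule coeffs_product_summable[OF F G])
  have "\<forall>\<^sub>F (i, m) in sequentially \<times>\<^sub>F sequentially. norm (a i m) \<le> M i"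
    using le by (intro always_eventually) auto
  from tannerys_theorem[OF lim this M]
  have *: "summable (\<lambda>i. norm (b i))" "(\<lambda>m. suminf (\<lambda>i. a i m)) \<longlonglongrightarrow> suminf b"
    by auto
  have "suminf (\<lambda>i. a i m) = (LINT w|dA. indicator (cball 0 (rad m)) w * ?H w)" for m
    using disk_parseval[OF F(1) G(1) rad(1,2), of e m k] unfolding a_def by (rule sums_unique[symmetric])
  moreover have "integrable dA ?H"
  proof -
    have "integrable dA (\<lambda>w. F w * cnj (G w) * (w ^ k * cnj w ^ (k + e)))"
      by (intro integrable_mult_monomial integrable_mult_L2_disk L2_disk_cnj F G)
    then show ?thesis by (simp add: mult_ac)
  qed
  ultimately have "(\<lambda>m. suminf (\<lambda>i. a i m)) \<longlonglongrightarrow> (LINT w|dA. ?H w)"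
    using integral_exhaustion[of ?H] by simp
  with *(2) have "suminf b = (LINT w|dA. ?H w)"
    by (rule LIMSEQ_unique)
  moreover have "b sums suminf b"
    by (rule summable_sums[OF summable_norm_cancel[OF *(1)]])
  moreover have "b = (\<lambda>i. A (i + e) * cnj (B i) / (i + k + e + 1))"
    by (rule ext) (simp only: b_def of_real_divide of_real_1 of_real_of_nat_eq times_divide_eq_right mult_1_right)
  ultimately show ?thesis by simp
qed

text \<open>The kernel expands as \<open>1 / (1 - x)\<^sup>2 = \<Sum> (j + 1) x\<^sup>j\<close> with \<open>x = z cnj w\<close>.\<close>

lemma bergman_proj_expands:
  assumes u: "integrable dA u"
  shows "expands (bergman_proj u) (\<lambda>j. of_nat (j + 1) * moment u j)"
  unfolding expands_def
proof
  fix z assume "z \<in> \<bbbD>"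
  then have z: "cmod z < 1" by simp
  define s where "s j w = of_nat (Suc j) * z ^ j * (u w * cnj w ^ j)" for j w
  have int: "integrable dA (s j)" for j
    unfolding s_def using integrable_moment[OF u] by simp
  have bound: "cmod (s j w) \<le> Suc j * cmod z ^ j * cmod (u w)" if "w \<in> \<bbbD>" for j w
  proof -
    have "cmod w ^ j \<le> 1" using that by (intro power_le_one) auto
    then have "cmod (u w) * cmod w ^ j \<le> cmod (u w)"
      by (intro mult_right_le_one_le) auto
    then show ?thesis
      unfolding s_def norm_mult norm_power norm_of_nat complex_mod_cnj
      by (intro mult_left_mono) auto
  qed
  have sm: "summable (\<lambda>j. Suc j * cmod z ^ j * c)" for c
    using geometric_deriv_sums[of "cmod z"] z by (intro summable_mult2) (auto simp: sums_iff)
  have AE: "AE w in dA. summable (\<lambda>j. norm (s j w))"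
    by (intro AE_I2 summable_comparison_test[OF _ sm]) (use bound in auto)
  have sm': "summable (\<lambda>j. LINT w|dA. norm (s j w))"
  proof (rule summable_comparison_test[OF _ sm[of "LINT w|dA. cmod (u w)"]])
    have "(LINT w|dA. norm (s j w)) \<le> (LINT w|dA. Suc j * cmod z ^ j * cmod (u w))" for j
      using int u bound by (intro integral_mono) auto
    then show "\<exists>N. \<forall>j\<ge>N. norm (LINT w|dA. norm (s j w)) \<le> Suc j * cmod z ^ j * (LINT w|dA. cmod (u w))"
      by (auto simp del: of_nat_Suc)
  qed
  have S: "(\<Sum>j. s j w) = u w / (1 - z * cnj w)\<^sup>2" if "w \<in> space dA" for w
  proof -
    have "cmod z * cmod w < 1 * 1"
      using z that by (intro mult_strict_mono') auto
    then have "norm (z * cnj w) < 1"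
      by (simp add: norm_mult)
    from sums_mult2[OF geometric_deriv_sums[OF this], of "u w"]
    have "(\<lambda>j. s j w) sums (1 / (1 - z * cnj w)\<^sup>2 * u w)"
      by (simp add: s_def power_mult_distrib mult_ac)
    then show ?thesis
      by (simp add: sums_iff)
  qed
  have "(LINT w|dA. (\<Sum>j. s j w)) = bergman_proj u z"
    unfolding bergman_proj_def by (rule Bochner_Integration.integral_cong[OF refl]) (rule S)
  moreover have "(LINT w|dA. s j w) = of_nat (j + 1) * moment u j * z ^ j" for j
  proof -
    have "(LINT w|dA. s j w) = of_nat (Suc j) * z ^ j * moment u j"
      by (simp add: s_def moment_def)
    then show ?thesis by (simp add: mult_ac)
  qed
  ultimately show "(\<lambda>j. of_nat (j + 1) * moment u j * z ^ j) sums bergman_proj u z"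
    using sums_integral[OF int AE sm'] by simp
qed

section \<open>Injectivity of a Hilbert-type matrix\<close>

text \<open>
  Summation by parts: \<open>D(min j k)\<close> is the sum of the increments \<open>D(i) - D(i - 1)\<close> over all \<open>i\<close> with
  \<open>i \<le> j\<close> and \<open>i \<le> k\<close>. The increment at \<open>i = 0\<close> is zero by truncated subtraction.
\<close>

lemma min_kernel_sum_of_squares:
  fixes D :: "nat \<Rightarrow> real" and v :: "nat \<Rightarrow> complex"
  assumes "D 0 = 0"
  shows "(\<Sum>(j, k)\<in>{..<N} \<times> {..<N}. of_real (D (min j k)) * v j * cnj (v k)) =
    of_real (\<Sum>i<N. (D i - D (i - 1)) * (cmod (\<Sum>j\<in>{i..<N}. v j))\<^sup>2)"
proof -
  have D: "D m = (\<Sum>i\<le>m. D i - D (i - 1))" for m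
    by (induction m) (simp_all add: assms)
  have D': "of_real (D (min j k)) * v j * cnj (v k) =
      (\<Sum>i<N. of_real (D i - D (i - 1)) * ((if i \<le> j then v j else 0) * cnj (if i \<le> k then v k else 0)))"
    if "j < N" "k < N" for j k
  proof -
    have "of_real (D (min j k)) * v j * cnj (v k) =
        (\<Sum>i\<le>min j k. of_real (D i - D (i - 1)) * (v j * cnj (v k)))"
      by (subst D) (simp add: sum_distrib_right mult.assoc)
    also have "\<dots> = (\<Sum>i<N. if i \<le> min j k then of_real (D i - D (i - 1)) * (v j * cnj (v k)) else 0)"
      using that by (intro sum.mono_neutral_cong_left) auto
    also have "\<dots> = (\<Sum>i<N. of_real (D i - D (i - 1)) * ((if i \<le> j then v j else 0) * cnj (if i \<le> k then v k else 0)))"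
      by (intro sum.cong) auto
    finally show ?thesis .
  qed
  have "(\<Sum>(j, k)\<in>{..<N} \<times> {..<N}. of_real (D (min j k)) * v j * cnj (v k)) =
    (\<Sum>j<N. \<Sum>k<N. \<Sum>i<N. of_real (D i - D (i - 1)) * ((if i \<le> j then v j else 0) * cnj (if i \<le> k then v k else 0)))"
    by (subst sum.cartesian_product[symmetric]) (intro sum.cong refl D', auto)
  also have "\<dots> = (\<Sum>i<N. \<Sum>j<N. \<Sum>k<N. of_real (D i - D (i - 1)) * ((if i \<le> j then v j else 0) * cnj (if i \<le> k then v k else 0)))"
    by (subst sum.swap[of _ "{..<N}" "{..<N}"], subst (2) sum.swap, rule refl)
  also have "\<dots> = (\<Sum>i<N. of_real (D i - D (i - 1)) *
      ((\<Sum>j<N. if i \<le> j then v j else 0) * cnj (\<Sum>k<N. if i \<le> k then v k else 0)))"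
    by (simp only: cnj_sum sum_product) (simp only: sum_distrib_left)
  also have "\<dots> = (\<Sum>i<N. of_real (D i - D (i - 1)) * of_real ((cmod (\<Sum>j\<in>{i..<N}. v j))\<^sup>2))"
  proof (intro sum.cong refl)
    fix i
    have "(\<Sum>j<N. if i \<le> j then v j else 0) = (\<Sum>j\<in>{i..<N}. v j)"
      by (intro sum.mono_neutral_cong_right) auto
    then show "of_real (D i - D (i - 1)) *
        ((\<Sum>j<N. if i \<le> j then v j else 0) * cnj (\<Sum>k<N. if i \<le> k then v k else 0)) =
        of_real (D i - D (i - 1)) * complex_of_real ((cmod (\<Sum>j\<in>{i..<N}. v j))\<^sup>2)"
      by (simp only: complex_norm_square)
  qed
  finally show ?thesis by simp
qed

text \<open>
  The square truncations of the form tend to zero and dominate each of their weighted squares, so the tail sums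
  of \<open>v\<close> from any \<open>i \<ge> 1\<close> tend to zero; consecutive tails differ by \<open>v\<^sub>i\<close>.
\<close>

lemma min_kernel_definite:
  fixes D :: "nat \<Rightarrow> real" and v :: "nat \<Rightarrow> complex"
  assumes D: "D 0 = 0" "strict_mono D"
    and sum: "((\<lambda>(j, k). of_real (D (min j k)) * v j * cnj (v k)) has_sum 0) UNIV"
    and "1 \<le> i"
  shows "v i = 0"
proof -
  define S where "S N = (\<Sum>i<N. (D i - D (i - 1)) * (cmod (\<Sum>j\<in>{i..<N}. v j))\<^sup>2)" for N
  have squares: "filterlim (\<lambda>N. {..<N} \<times> {..<N}) (finite_subsets_at_top (UNIV :: (nat \<times> nat) set)) sequentially"
    unfolding filterlim_finite_subsets_at_top
  proof (intro allI impI)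
    fix X :: "(nat \<times> nat) set" assume "finite X \<and> X \<subseteq> UNIV"
    then have "finite (fst ` X \<union> snd ` X)" by simp
    then obtain M where "\<forall>n\<in>fst ` X \<union> snd ` X. n < M"
      using finite_nat_set_iff_bounded by blast
    then have "fst p < M \<and> snd p < M" if "p \<in> X" for p
      using that by blast
    then have "X \<subseteq> {..<N} \<times> {..<N}" if "M \<le> N" for N
      using that by (force simp: mem_Times_iff)
    then show "\<forall>\<^sub>F N in sequentially. finite ({..<N} \<times> {..<N}) \<and> X \<subseteq> {..<N} \<times> {..<N} \<and> {..<N} \<times> {..<N} \<subseteq> UNIV"
      by (auto simp: eventually_sequentially)
  qed
  have "(\<lambda>N. complex_of_real (S N)) \<longlonglongrightarrow> 0"
    using filterlim_compose[OF sum[unfolded has_sum_def] squares]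
    unfolding S_def min_kernel_sum_of_squares[where D = D and v = v, OF D(1)] .
  from tendsto_Re[OF this] have S0: "S \<longlonglongrightarrow> 0"
    by simp
  have tail: "(\<lambda>N. \<Sum>j\<in>{i..<N}. v j) \<longlonglongrightarrow> 0" if "1 \<le> i" for i
  proof -
    have pos: "0 < D i - D (i - 1)"
      using strict_monoD[OF D(2), of "i - 1" i] that by simp
    have nonneg: "0 \<le> D k - D (k - 1)" for k
      using strict_mono_mono[OF D(2)] by (simp add: monoD)
    have "(D i - D (i - 1)) * (cmod (\<Sum>j\<in>{i..<N}. v j))\<^sup>2 \<le> S N" if "i < N" for N
      unfolding S_def using that nonneg by (intro member_le_sum) auto
    then have le: "\<forall>\<^sub>F N in sequentially. (cmod (\<Sum>j\<in>{i..<N}. v j))\<^sup>2 \<le> S N / (D i - D (i - 1))"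
      using pos by (intro eventually_sequentiallyI[of "Suc i"]) (simp add: field_simps)
    have lim: "(\<lambda>N. S N / (D i - D (i - 1))) \<longlonglongrightarrow> 0"
      using tendsto_divide[OF S0 tendsto_const[of "D i - D (i - 1)"]] pos by simp
    have "(\<lambda>N. (cmod (\<Sum>j\<in>{i..<N}. v j))\<^sup>2) \<longlonglongrightarrow> 0"
      by (rule tendsto_sandwich[OF _ le tendsto_const lim]) simp
    from tendsto_real_sqrt[OF this] show ?thesis
      by (simp add: tendsto_norm_zero_iff)
  qed
  have "(\<lambda>N. (\<Sum>j\<in>{i..<N}. v j) - (\<Sum>j\<in>{Suc i..<N}. v j)) \<longlonglongrightarrow> 0 - 0"
    using \<open>1 \<le> i\<close> by (intro tendsto_diff tail) auto
  moreover have "\<forall>\<^sub>F N in sequentially. (\<Sum>j\<in>{i..<N}. v j) - (\<Sum>j\<in>{Suc i..<N}. v j) = v i"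
    by (intro eventually_sequentiallyI[of "Suc i"]) (simp add: sum.atLeast_Suc_lessThan)
  ultimately have "(\<lambda>N. v i) \<longlonglongrightarrow> 0"
    using Lim_transform_eventually by fastforce
  then show ?thesis
    by (simp add: LIMSEQ_const_iff)
qed

text \<open>
  With \<open>n = j\<close> and \<open>m = j + e\<close>, the indices of the coefficients in \<open>x\<^sub>j = a\<^sub>m cnj b\<^sub>n\<close>, this is
  \<open>n m (n + 1) (m + 1)\<close>.
\<close>

definition quartic :: "nat \<Rightarrow> nat \<Rightarrow> real"
  where "quartic e j = real (j * (j + e) * ((j + 1) * (j + e + 1)))"

lemma strict_mono_quartic: "strict_mono (quartic e)"
proof (rule strict_monoI)
  fix m n :: nat assume "m < n"
  then have le: "(m + 1) * (m + e + 1) \<le> (n + 1) * (n + e + 1)"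
    by (intro mult_mono) auto
  have "m * (m + e) < n * (n + e)"
    using \<open>m < n\<close> by (intro mult_strict_mono') auto
  from mult_less_le_imp_less[OF this le]
  have "m * (m + e) * ((m + 1) * (m + e + 1)) < n * (n + e) * ((n + 1) * (n + e + 1))"
    by simp
  then show "quartic e m < quartic e n"
    unfolding quartic_def by (simp only: of_nat_less_iff)
qed

text \<open>
  Multiplying the \<open>k\<close>-th equation by \<open>cnj z\<^sub>k\<close> alone gives a double series that need not converge
  absolutely. With the additional weight \<open>1 / (2 k + e + 1)\<close> its terms are at most \<open>y\<^sub>k y\<^sub>j\<close>, where
  \<open>y\<^sub>j = \<bar>x\<^sub>j\<bar> / (j + e + 1)\<close>, and adding the
  conjugate of the transposed series removes the denominator \<open>j + k + e + 1\<close>.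
\<close>

lemma hilbert_min_kernel_injective:
  fixes x :: "nat \<Rightarrow> complex"
  assumes x: "summable (\<lambda>j. cmod (x j) / (j + e + 1))"
    and eq: "\<And>k. (\<lambda>j. of_real (quartic e (min j k) / (j + k + e + 1)) * (x j / of_nat ((j + 1) * (j + e + 1)))) sums 0"
    and "1 \<le> i"
  shows "x i = 0"
proof -
  define y where "y j = cmod (x j) / (j + e + 1)" for j
  define z where "z j = x j / of_nat ((j + 1) * (j + e + 1))" for j
  define v where "v j = z j / of_nat (2 * j + e + 1)" for j
  define T where "T = (\<lambda>(k, j). of_real (quartic e (min j k) / (j + k + e + 1)) * z j *
    (cnj (z k) / of_nat (2 * k + e + 1)))"
  have y0: "0 \<le> y j" for j by (simp add: y_def)
  have cmod_z: "cmod (z j) = y j / (j + 1)" for j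
    by (simp add: z_def y_def norm_divide norm_mult del: of_nat_add of_nat_mult of_nat_Suc)
      (simp add: field_simps)
  have bound: "cmod (T (k, j)) \<le> y k * y j" for k j
  proof -
    define n where "n = min j k"
    have nj: "n \<le> j" and nk: "n \<le> k" by (auto simp: n_def)
    have "n * (n + e) * ((n + 1) * (n + e + 1)) \<le> ((n + 1) * (n + 1)) * ((n + e + 1) * (n + e + 1))"
      by (simp add: mult_mono algebra_simps)
    also have "\<dots> \<le> ((j + 1) * (k + 1)) * ((j + k + e + 1) * (2 * k + e + 1))"
      using nj nk by (intro mult_mono) auto
    finally have q: "quartic e n \<le> real (((j + 1) * (k + 1)) * ((j + k + e + 1) * (2 * k + e + 1)))"
      unfolding quartic_def by (simp only: of_nat_le_iff)
    have q0: "0 \<le> quartic e n" by (simp add: quartic_def)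
    have "cmod (T (k, j)) = quartic e n / (j + k + e + 1) * (y j / (j + 1)) * (y k / (k + 1) / (2 * k + e + 1))"
      using q0 by (simp add: T_def norm_mult norm_divide cmod_z n_def[symmetric] del: of_nat_add of_nat_mult of_nat_Suc)
    also have "\<dots> = quartic e n / real (((j + 1) * (k + 1)) * ((j + k + e + 1) * (2 * k + e + 1))) * (y k * y j)"
      unfolding of_nat_mult by (simp add: mult_ac del: of_nat_add of_nat_Suc)
    also have "\<dots> \<le> 1 * (y k * y j)"
      using q y0 by (intro mult_right_mono) (auto simp del: of_nat_mult simp: divide_le_eq_1)
    finally show ?thesis by simp
  qed
  have y: "(y has_sum suminf y) UNIV"
  proof (rule norm_summable_imp_has_sum)
    have "summable y"
      using x unfolding y_def[abs_def] .
    then show "summable (\<lambda>j. norm (y j))" "y sums suminf y"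
      using y0 by (simp_all add: summable_sums)
  qed
  have "(\<lambda>(k, j). y k * y j) summable_on UNIV \<times> UNIV"
    using y0 by (intro summable_on_SigmaI[where g = "\<lambda>k. y k * suminf y"])
      (auto intro!: has_sum_cmult_right y summable_on_cmult_left has_sum_imp_summable[OF y])
  then have "(\<lambda>(k, j). y k * y j) summable_on UNIV"
    by simp
  then have "(\<lambda>p. norm (T p)) summable_on UNIV"
    by (rule Infinite_Sum.abs_summable_on_comparison_test'[where g = "\<lambda>(k, j). y k * y j"])
      (use bound in auto)
  then have T: "T summable_on UNIV"
    by (rule abs_summable_summable)
  have rows: "(\<Sum>\<^sub>\<infinity>j. T (k, j)) = 0" for k
  proof -
    have "(\<lambda>j. T (k, j)) summable_on UNIV"
      using summable_on_SigmaD1[of "\<lambda>k j. T (k, j)" UNIV "\<lambda>_. UNIV" k] T by simp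
    then have "(\<lambda>j. T (k, j)) sums (\<Sum>\<^sub>\<infinity>j. T (k, j))"
      by (intro has_sum_imp_sums has_sum_infsum)
    moreover have "(\<lambda>j. T (k, j)) sums (0 * (cnj (z k) / of_nat (2 * k + e + 1)))"
      unfolding T_def prod.case by (rule sums_mult2) (use eq[of k] in \<open>simp add: z_def\<close>)
    ultimately show ?thesis using sums_unique2 by fastforce
  qed
  have "infsum T UNIV = 0"
    using infsum_Sigma_banach[of T UNIV "\<lambda>_. UNIV"] T by (simp add: rows)
  then have T0: "(T has_sum 0) UNIV"
    using T has_sum_infsum by metis
  then have "((\<lambda>(j, k). T (k, j)) has_sum 0) UNIV"
    using has_sum_swap[where f = T and S = 0 and A = UNIV and B = UNIV] by simp
  then have "((\<lambda>p. cnj (case p of (j, k) \<Rightarrow> T (k, j))) has_sum cnj 0) UNIV"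
    by (simp only: has_sum_cnj_iff)
  from has_sum_add[OF this T0]
  have "((\<lambda>(k, j). cnj (T (j, k)) + T (k, j)) has_sum 0) UNIV"
    by (simp add: case_prod_unfold)
  also have "(\<lambda>(k, j). cnj (T (j, k)) + T (k, j)) = (\<lambda>(k, j). 2 * (of_real (quartic e (min k j)) * cnj (v k) * v j))"
  proof -
    have "cnj (T (j, k)) + T (k, j) = 2 * (of_real (quartic e (min k j)) * cnj (v k) * v j)" for j k
    proof -
      define q where "q = complex_of_real (quartic e (min k j))"
      define a b s :: complex where "a = of_nat (2 * j + e + 1)" "b = of_nat (2 * k + e + 1)" "s = of_nat (j + k + e + 1)"
      have nz: "a \<noteq> 0" "b \<noteq> 0" "s \<noteq> 0"
        unfolding a_b_s_def by (simp_all only: of_nat_eq_0_iff)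
      have ab: "a + b = 2 * s" by (simp add: a_b_s_def)
      have cnj: "cnj q = q" "cnj a = a" "cnj s = s"
        by (simp_all only: a_b_s_def q_def complex_cnj_of_nat complex_cnj_complex_of_real)
      have "T (k, j) = q / s * z j * (cnj (z k) / b)"
        by (simp only: T_def prod.case q_def a_b_s_def of_real_divide of_real_of_nat_eq min.commute[of j])
      moreover
      have T2: "T (j, k) = q / s * z k * (cnj (z j) / a)"
        by (simp only: T_def prod.case q_def a_b_s_def of_real_divide of_real_of_nat_eq add.commute[of k j])
      have "cnj (T (j, k)) = q / s * cnj (z k) * (z j / a)"
        unfolding T2 by (simp add: cnj)
      ultimately have "cnj (T (j, k)) + T (k, j) = q * cnj (z k) * z j * (a + b) / (s * a * b)"
        using nz by (simp add: cnj field_simps)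
      also have "\<dots> = 2 * (q * (cnj (z k) / b) * (z j / a))"
        using nz by (simp add: ab field_simps)
      finally show ?thesis
        by (simp only: q_def v_def a_b_s_def complex_cnj_divide complex_cnj_of_nat)
    qed
    then show ?thesis by auto
  qed
  finally have "((\<lambda>(j, k). of_real (quartic e (min j k)) * cnj (v j) * cnj (cnj (v k))) has_sum 0) UNIV"
    using has_sum_cmult_right_iff[where c = "2 :: complex" and S = 0 and A = UNIV
        and f = "\<lambda>(k, j). of_real (quartic e (min k j)) * cnj (v k) * v j"]
    by (simp add: case_prod_unfold)
  then have "cnj (v i) = 0"
    using \<open>1 \<le> i\<close> by (intro min_kernel_definite[where D = "quartic e"] strict_mono_quartic) (auto simp: quartic_def)
  then have "x i / of_nat ((i + 1) * (i + e + 1)) / of_nat (2 * i + e + 1) = 0"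
    by (simp only: v_def z_def complex_cnj_zero_iff)
  then show ?thesis
    by (simp del: of_nat_add of_nat_mult of_nat_Suc)
qed

section \<open>The Bergman and harmonic projections\<close>

lemma harmonic_proj_cong:
  assumes "\<And>w. w \<in> \<bbbD> \<Longrightarrow> u w = v w"
  shows "harmonic_proj u = harmonic_proj v"
proof -
  have "bergman_proj u = bergman_proj v"
    unfolding bergman_proj_def[abs_def] using assms by (intro ext Bochner_Integration.integral_cong) auto
  moreover have "bergman_proj (\<lambda>w. cnj (u w)) = bergman_proj (\<lambda>w. cnj (v w))"
    unfolding bergman_proj_def[abs_def] using assms by (intro ext Bochner_Integration.integral_cong) auto
  ultimately show ?thesis
    by (simp add: harmonic_proj_def[abs_def])
qed

lemma bergman_proj_cmult: "bergman_proj (\<lambda>w. c * u w) z = c * bergman_proj u z"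
proof -
  have "bergman_proj (\<lambda>w. c * u w) z = (LINT w|dA. c * (u w / (1 - z * cnj w)\<^sup>2))"
    by (simp add: bergman_proj_def)
  then show ?thesis
    unfolding bergman_proj_def by (simp only: integral_mult_right_zero)
qed

lemma harmonic_proj_cmult: "harmonic_proj (\<lambda>w. c * u w) z = c * harmonic_proj u z"
  by (simp add: harmonic_proj_def bergman_proj_cmult algebra_simps)

lemma bergman_proj_diff:
  assumes "integrable dA u" "integrable dA v" "z \<in> \<bbbD>"
  shows "bergman_proj (\<lambda>w. u w - v w) z = bergman_proj u z - bergman_proj v z"
proof -
  have "(\<lambda>j. of_nat (j + 1) * moment (\<lambda>w. u w - v w) j * z ^ j) sums bergman_proj (\<lambda>w. u w - v w) z"
    using assms by (intro expandsD[OF bergman_proj_expands]) auto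
  moreover have "(\<lambda>j. of_nat (j + 1) * moment u j * z ^ j - of_nat (j + 1) * moment v j * z ^ j) sums
      (bergman_proj u z - bergman_proj v z)"
    using assms by (intro sums_diff expandsD[OF bergman_proj_expands]) auto
  ultimately show ?thesis
    unfolding moment_diff[OF assms(1,2)] right_diff_distrib left_diff_distrib by (rule sums_unique2)
qed

lemma harmonic_proj_diff:
  assumes "integrable dA u" "integrable dA v" "z \<in> \<bbbD>"
  shows "harmonic_proj (\<lambda>w. u w - v w) z = harmonic_proj u z - harmonic_proj v z"
proof -
  have "bergman_proj (\<lambda>w. u w - v w) z = bergman_proj u z - bergman_proj v z"
    "bergman_proj (\<lambda>w. u w - v w) 0 = bergman_proj u 0 - bergman_proj v 0"
    "bergman_proj (\<lambda>w. cnj (u w) - cnj (v w)) z = bergman_proj (\<lambda>w. cnj (u w)) z - bergman_proj (\<lambda>w. cnj (v w)) z"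
    by (intro bergman_proj_diff integrable_cnj assms; simp)+
  then show ?thesis
    by (simp only: harmonic_proj_def complex_cnj_diff) simp
qed

lemma expands_at_0: "expands F A \<Longrightarrow> F 0 = A 0"
  using expandsD[of F A 0] powser_sums_zero[of A] sums_unique2 by fastforce

lemma bergman_proj_at_0: "integrable dA u \<Longrightarrow> bergman_proj u 0 = moment u 0"
  using expands_at_0[OF bergman_proj_expands] by simp

lemma expands_add_const:
  assumes "expands F A"
  shows "expands (\<lambda>w. F w + c) (\<lambda>j. A j + (if j = 0 then c else 0))"
  unfolding expands_def
proof
  fix w assume "w \<in> \<bbbD>"
  then have "(\<lambda>j. A j * w ^ j + (if j = 0 then c else 0)) sums (F w + c)"
    by (intro sums_add expandsD[OF assms] sums_single)
  then show "(\<lambda>j. (A j + (if j = 0 then c else 0)) * w ^ j) sums (F w + c)"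
    by (rule sums_cong[THEN iffD1, rotated]) (simp add: algebra_simps)
qed

lemma L2_disk_const: "(\<lambda>_. c) \<in> L2_disk"
  by (rule L2_disk_bounded[where B = "cmod c"]) auto

lemma bergman_proj_L2:
  assumes u: "u \<in> L2_disk"
  shows "bergman_proj u \<in> L2_disk"
proof (rule L2_disk_if_coeffs[OF bergman_proj_expands[OF integrable_L2_disk[OF u]]])
  have "(cmod (of_nat (n + 1) * moment u n))\<^sup>2 / real (n + 1) = real (n + 1) * (cmod (moment u n))\<^sup>2" for n
    unfolding norm_mult norm_of_nat power_mult_distrib by (simp add: power2_eq_square del: of_nat_add of_nat_Suc)
  then show "summable (\<lambda>n. (cmod (of_nat (n + 1) * moment u n))\<^sup>2 / real (n + 1))"
    using bessel_disk[OF u] by (simp only:)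
qed

text \<open>
  The harmonic Bergman space: square integrable harmonic functions on the disk are the sums of an
  analytic and an antianalytic square integrable function.
\<close>

definition harmonic_bergman :: "(complex \<Rightarrow> complex) set"
  where "harmonic_bergman = {u. \<exists>F G A B. expands F A \<and> F \<in> L2_disk \<and> expands G B \<and> G \<in> L2_disk \<and>
    (\<forall>w\<in>\<bbbD>. u w = F w + cnj (G w))}"

lemma harmonic_bergmanI:
  assumes "expands F A" "F \<in> L2_disk" "expands G B" "G \<in> L2_disk"
    "\<And>w. w \<in> \<bbbD> \<Longrightarrow> u w = F w + cnj (G w)"
  shows "u \<in> harmonic_bergman"
  unfolding harmonic_bergman_def mem_Collect_eq
  by (rule exI[of _ F], rule exI[of _ G], rule exI[of _ A], rule exI[of _ B]) (simp add: assms)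

lemma harmonic_bergman_L2:
  assumes "u \<in> harmonic_bergman"
  shows "u \<in> L2_disk"
proof -
  obtain F G where "F \<in> L2_disk" "G \<in> L2_disk" and eq: "\<forall>w\<in>\<bbbD>. u w = F w + cnj (G w)"
    using assms unfolding harmonic_bergman_def mem_Collect_eq by (elim exE conjE)
  from L2_disk_add[OF this(1) L2_disk_cnj[OF this(2)]] show ?thesis
    by (rule L2_disk_cong) (simp add: eq)
qed

text \<open>
  The analytic and the antianalytic part are square integrable by Bessel's inequality, because the
  coefficients of \<open>P u\<close> are the moments of \<open>u\<close> times \<open>j + 1\<close>.
\<close>

lemma harmonic_proj_mem:
  assumes u: "u \<in> L2_disk"
  shows "harmonic_proj u \<in> harmonic_bergman"
proof (rule harmonic_bergmanI)
  let ?v = "\<lambda>w. cnj (u w)"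
  show "expands (\<lambda>w. bergman_proj u w + (- bergman_proj u 0))
      (\<lambda>j. of_nat (j + 1) * moment u j + (if j = 0 then - bergman_proj u 0 else 0))"
    by (intro expands_add_const bergman_proj_expands integrable_L2_disk u)
  show "(\<lambda>w. bergman_proj u w + (- bergman_proj u 0)) \<in> L2_disk"
    by (intro L2_disk_add L2_disk_const bergman_proj_L2 u)
  show "expands (bergman_proj ?v) (\<lambda>j. of_nat (j + 1) * moment ?v j)"
    by (intro bergman_proj_expands integrable_L2_disk L2_disk_cnj u)
  show "bergman_proj ?v \<in> L2_disk"
    by (intro bergman_proj_L2 L2_disk_cnj u)
qed (simp add: harmonic_proj_def)

lemma bergman_proj_harmonic:
  assumes F: "expands F A" "F \<in> L2_disk" and G: "expands G B" "G \<in> L2_disk" and z: "z \<in> \<bbbD>"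
  shows "bergman_proj (\<lambda>w. F w + cnj (G w)) z = F z + cnj (G 0)"
proof -
  let ?u = "\<lambda>w. F w + cnj (G w)"
  have int: "integrable dA F" "integrable dA G"
    using F G by (simp_all add: integrable_L2_disk)
  have "moment ?u j = A j / of_nat (j + 1) + (if j = 0 then cnj (G 0) else 0)" for j
  proof -
    have "moment (\<lambda>w. cnj (G w)) j = cnj (LINT w|dA. G w * (w ^ j * cnj w ^ 0))"
      unfolding moment_def by (subst Bochner_Integration.integral_cnj[symmetric]) simp
    also have "\<dots> = (if j = 0 then cnj (G 0) else 0)"
      using expands_moment[OF G(1) int(2), of j 0] expands_at_0[OF G(1)] by simp
    finally have "moment (\<lambda>w. cnj (G w)) j = (if j = 0 then cnj (G 0) else 0)" .
    moreover have "moment ?u j = moment F j + moment (\<lambda>w. cnj (G w)) j"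
      unfolding moment_def distrib_right
      by (intro Bochner_Integration.integral_add integrable_moment int integrable_cnj)
    ultimately show ?thesis
      by (simp add: moment_expands[OF F(1) int(1)])
  qed
  then have "of_nat (j + 1) * moment ?u j = A j + (if j = 0 then cnj (G 0) else 0)" for j
    by (simp add: distrib_left del: of_nat_add of_nat_Suc)
  then have "expands (bergman_proj ?u) (\<lambda>j. A j + (if j = 0 then cnj (G 0) else 0))"
    using bergman_proj_expands[of ?u] int by simp
  from expandsD[OF this z] expandsD[OF expands_add_const[OF F(1)] z] show ?thesis
    by (rule sums_unique2)
qed

lemma harmonic_proj_fixes:
  assumes u: "u \<in> harmonic_bergman" and z: "z \<in> \<bbbD>"
  shows "harmonic_proj u z = u z"
proof -
  obtain F G A B where F: "expands F A" "F \<in> L2_disk" and G: "expands G B" "G \<in> L2_disk"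
    and eq: "\<And>w. w \<in> \<bbbD> \<Longrightarrow> u w = F w + cnj (G w)"
    using u unfolding harmonic_bergman_def mem_Collect_eq by (elim exE conjE) simp
  have "harmonic_proj u z = harmonic_proj (\<lambda>w. F w + cnj (G w)) z"
    by (subst harmonic_proj_cong[OF eq]) auto
  also have "\<dots> = F z + cnj (G z)"
    using bergman_proj_harmonic[OF F G z] bergman_proj_harmonic[OF F G, of 0] bergman_proj_harmonic[OF G F z]
    by (simp add: harmonic_proj_def add.commute)
  finally show ?thesis using eq[OF z] by simp
qed

text \<open>
  Analytic and antianalytic monomials are orthogonal on every disk around the origin. The functions
  need not be integrable on the unit disk, so a smaller disk is used.
\<close>

lemma harmonic_zero_imp_coeff_zero:
  assumes F: "expands F A" and G: "expands G B" and zero: "\<And>w. w \<in> \<bbbD> \<Longrightarrow> F w + cnj (G w) = 0"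
    and l: "1 \<le> l"
  shows "A l = 0"
proof -
  let ?D = "\<lambda>w. indicator (cball 0 (1/2)) w :: complex"
  have mono: "integrable dA (\<lambda>w. w ^ m * cnj w ^ n)" for m n
    using integrable_mult_monomial[of "\<lambda>_. 1" m n] by simp
  have iF: "integrable dA (\<lambda>w. ?D w * (F w * (w ^ 0 * cnj w ^ l)))"
    and iG: "integrable dA (\<lambda>w. ?D w * (G w * (w ^ l * cnj w ^ 0)))"
    using disk_integral_sums(1)[OF F _ _ mono, of "1/2" 0 l] disk_integral_sums(1)[OF G _ _ mono, of "1/2" l 0]
    by simp_all
  have "0 = (LINT w|dA. ?D w * (F w * (w ^ 0 * cnj w ^ l)) + cnj (?D w * (G w * (w ^ l * cnj w ^ 0))))"
  proof -
    have "?D w * (F w * (w ^ 0 * cnj w ^ l)) + cnj (?D w * (G w * (w ^ l * cnj w ^ 0))) = 0" if "w \<in> \<bbbD>" for w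
    proof -
      have "?D w * (F w * (w ^ 0 * cnj w ^ l)) + cnj (?D w * (G w * (w ^ l * cnj w ^ 0))) =
          ?D w * cnj w ^ l * (F w + cnj (G w))"
        by (simp add: algebra_simps indicator_def)
      then show ?thesis using zero[OF that] by simp
    qed
    then have "(LINT w|dA. ?D w * (F w * (w ^ 0 * cnj w ^ l)) + cnj (?D w * (G w * (w ^ l * cnj w ^ 0)))) = (LINT w|dA. 0)"
      by (intro Bochner_Integration.integral_cong) auto
    then show ?thesis by simp
  qed
  also have "\<dots> = (LINT w|dA. ?D w * (F w * (w ^ 0 * cnj w ^ l))) + cnj (LINT w|dA. ?D w * (G w * (w ^ l * cnj w ^ 0)))"
    using Bochner_Integration.integral_add[OF iF integrable_cnj[OF iG]] by (simp only: Bochner_Integration.integral_cnj)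
  also have "\<dots> = A l * of_real ((1/2) ^ (2 * l + 2) / (l + 1))"
    using disk_moment[OF F, of "1/2" 0 l] disk_moment[OF G, of "1/2" l 0] l by simp
  finally have "A l * of_real ((1/2) ^ (2 * l + 2) / (l + 1)) = 0"
    by simp
  moreover have "(1/2 :: real) ^ (2 * l + 2) / (l + 1) \<noteq> 0"
    by simp
  ultimately show ?thesis
    by (simp only: mult_eq_0_iff of_real_eq_0_iff) blast
qed

text \<open>
  The moments are, up to nonzero factors, the coefficients of the analytic part of the projection.
  The constant term is special, because it is shared with the antianalytic part: it is read off from
  the value at the origin.
\<close>

lemma moment_zero_if_harmonic_proj_zero:
  assumes v: "integrable dA v" and zero: "\<And>z. z \<in> \<bbbD> \<Longrightarrow> harmonic_proj v z = 0"
  shows "moment v l = 0"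
proof (cases "l = 0")
  case True
  have "harmonic_proj v 0 = 0" by (simp add: zero)
  then have "moment (\<lambda>w. cnj (v w)) 0 = 0"
    using bergman_proj_at_0[OF integrable_cnj[OF v]] by (simp add: harmonic_proj_def)
  then show ?thesis
    using True by (simp add: moment_def)
next
  case False
  have "of_nat (l + 1) * moment v l + (if l = 0 then - bergman_proj v 0 else 0) = 0"
  proof (rule harmonic_zero_imp_coeff_zero[where A = "\<lambda>j. of_nat (j + 1) * moment v j + (if j = 0 then - bergman_proj v 0 else 0)"])
    show "expands (\<lambda>w. bergman_proj v w + (- bergman_proj v 0))
        (\<lambda>j. of_nat (j + 1) * moment v j + (if j = 0 then - bergman_proj v 0 else 0))"
      by (intro expands_add_const bergman_proj_expands v)
    show "expands (bergman_proj (\<lambda>w. cnj (v w))) (\<lambda>j. of_nat (j + 1) * moment (\<lambda>w. cnj (v w)) j)"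
      by (intro bergman_proj_expands integrable_cnj v)
    show "bergman_proj v w + (- bergman_proj v 0) + cnj (bergman_proj (\<lambda>w. cnj (v w)) w) = 0" if "w \<in> \<bbbD>" for w
      using zero[OF that] by (simp add: harmonic_proj_def algebra_simps)
  qed (use False in simp)
  then show ?thesis
    using False by (simp del: of_nat_add of_nat_Suc)
qed

lemma moment_eq_if_harmonic_proj_eq:
  assumes "integrable dA u" "integrable dA v" "\<And>z. z \<in> \<bbbD> \<Longrightarrow> harmonic_proj u z = harmonic_proj v z"
  shows "moment u l = moment v l"
proof -
  have "moment (\<lambda>w. u w - v w) l = 0"
    using assms by (intro moment_zero_if_harmonic_proj_zero) (auto simp: harmonic_proj_diff)
  then show ?thesis using moment_diff[OF assms(1,2)] by simp
qed

section \<open>Toeplitz operators\<close>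

lemma harmonic_polynomial_regular:
  assumes "p \<in> harmonic_polynomials"
  shows "p \<in> harmonic_bergman" "\<exists>B. \<forall>w\<in>\<bbbD>. cmod (p w) \<le> B" "p \<in> borel_measurable dA"
proof -
  obtain n a b where p: "p = (\<lambda>z. \<Sum>k\<le>n. a k * z ^ k + b k * cnj z ^ k)"
    using assms unfolding harmonic_polynomials_def by blast
  show "p \<in> harmonic_bergman"
    by (rule harmonic_bergmanI[OF expands_polynomial[of a "Suc n"] L2_disk_polynomial
          expands_polynomial[of "\<lambda>k. cnj (b k)" "Suc n"] L2_disk_polynomial])
      (simp add: p sum.distrib lessThan_Suc_atMost)
  have cont: "continuous_on UNIV p"
    unfolding p by (intro continuous_intros)
  then show "p \<in> borel_measurable dA"
    by (rule continuous_dA)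
  have "compact (p ` cball 0 1)"
    by (intro compact_continuous_image continuous_on_subset[OF cont]) auto
  then obtain B where "\<forall>y\<in>p ` cball 0 1. cmod y \<le> B"
    using compact_imp_bounded bounded_iff by metis
  then show "\<exists>B. \<forall>w\<in>\<bbbD>. cmod (p w) \<le> B"
    by (intro exI[of _ B]) auto
qed

lemma L2_disk_mult_harmonic_polynomial:
  assumes "u \<in> L2_disk" "p \<in> harmonic_polynomials"
  shows "(\<lambda>w. u w * p w) \<in> L2_disk"
  using harmonic_polynomial_regular[OF assms(2)] L2_disk_mult_bounded[OF assms(1)] by blast

lemma toeplitz_constant_commutes:
  assumes \<phi>: "\<And>w. w \<in> \<bbbD> \<Longrightarrow> \<phi> w = c" and \<psi>: "\<psi> \<in> L2_disk"
    and p: "p \<in> harmonic_polynomials" and z: "z \<in> \<bbbD>"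
  shows "toeplitz \<phi> (toeplitz \<psi> p) z = toeplitz \<psi> (toeplitz \<phi> p) z"
proof -
  let ?u = "\<lambda>w. \<psi> w * p w"
  have "toeplitz \<phi> (toeplitz \<psi> p) z = harmonic_proj (\<lambda>w. c * harmonic_proj ?u w) z"
    unfolding toeplitz_def by (subst harmonic_proj_cong[where v = "\<lambda>w. c * harmonic_proj ?u w"]) (simp_all add: \<phi>)
  also have "\<dots> = c * harmonic_proj ?u z"
    by (simp add: harmonic_proj_cmult harmonic_proj_fixes[OF harmonic_proj_mem z]
        L2_disk_mult_harmonic_polynomial \<psi> p)
  finally have 1: "toeplitz \<phi> (toeplitz \<psi> p) z = c * harmonic_proj ?u z" .
  have "toeplitz \<phi> p w = c * p w" if "w \<in> \<bbbD>" for w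
  proof -
    have "toeplitz \<phi> p w = harmonic_proj (\<lambda>w. c * p w) w"
      unfolding toeplitz_def by (subst harmonic_proj_cong[where v = "\<lambda>w. c * p w"]) (simp_all add: \<phi>)
    then show ?thesis
      by (simp add: harmonic_proj_cmult harmonic_proj_fixes[OF harmonic_polynomial_regular(1)[OF p] that])
  qed
  then have "toeplitz \<psi> (toeplitz \<phi> p) z = harmonic_proj (\<lambda>w. c * ?u w) z"
    unfolding toeplitz_def[of \<psi>] by (subst harmonic_proj_cong[where v = "\<lambda>w. c * ?u w"]) simp_all
  with 1 show ?thesis
    by (simp add: harmonic_proj_cmult)
qed

lemma bergman_space_expands:
  assumes "f \<in> bergman_space"
  obtains A where "expands f A" "f \<in> L2_disk"
proof
  show "f \<in> L2_disk"
    using assms by (simp add: bergman_space_def)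
  have "f holomorphic_on \<bbbD>"
    using assms by (simp add: bergman_space_def)
  from holomorphic_power_series[OF this]
  show "expands f (\<lambda>n. (deriv ^^ n) f 0 / fact n)"
    by (simp add: expands_def)
qed

lemma constant_on_disk:
  assumes F: "expands F A" and A: "\<And>n. 1 \<le> n \<Longrightarrow> A n = 0"
  shows "F constant_on \<bbbD>"
  unfolding constant_on_def
proof (intro exI ballI)
  fix w assume "w \<in> \<bbbD>"
  have "(\<lambda>n. A n * w ^ n) sums (\<Sum>n\<in>{0}. A n * w ^ n)"
    by (rule sums_finite) (auto simp: A)
  then show "F w = A 0"
    using sums_unique2[OF expandsD[OF F \<open>w \<in> \<bbbD>\<close>]] by simp
qed

text \<open>
  The number \<open>R\<close> is to be the moment of \<open>f Q(cnj g z\<^sup>k)\<close> against \<open>cnj z\<^sup>l\<close>. The finite sum comes from the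
  analytic part of the inner projection, the series from its antianalytic part, and the subtracted
  term from the constant, which belongs to both. In this form, unlike in its derivation, the
  identity is symmetric under conjugation and exchange of \<open>(a, l)\<close> and \<open>(b, k)\<close>.
\<close>

definition coeff_identity :: "(nat \<Rightarrow> complex) \<Rightarrow> (nat \<Rightarrow> complex) \<Rightarrow> nat \<Rightarrow> nat \<Rightarrow> complex \<Rightarrow> bool"
  where "coeff_identity a b k l R \<longleftrightarrow> (\<exists>S.
    (\<lambda>i. of_nat (i + 1) * a (i + l) * cnj (b (i + k)) / (of_nat (i + k + 1) * of_nat (i + l + 1))) sums S \<and>
    (\<Sum>j\<le>min k l. of_nat (j + 1) * a (l - j) * cnj (b (k - j)) / (of_nat (k + 1) * of_nat (l + 1))) + S
      - a l * cnj (b k) / (of_nat (k + 1) * of_nat (l + 1)) = R)"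

lemma coeff_identity_swap:
  assumes "coeff_identity a b k l R"
  shows "coeff_identity b a l k (cnj R)"
proof -
  obtain S where S: "(\<lambda>i. of_nat (i + 1) * a (i + l) * cnj (b (i + k)) / (of_nat (i + k + 1) * of_nat (i + l + 1))) sums S"
    and R: "(\<Sum>j\<le>min k l. of_nat (j + 1) * a (l - j) * cnj (b (k - j)) / (of_nat (k + 1) * of_nat (l + 1))) + S
      - a l * cnj (b k) / (of_nat (k + 1) * of_nat (l + 1)) = R"
    using assms unfolding coeff_identity_def by blast
  show ?thesis
    unfolding coeff_identity_def
  proof (intro exI conjI)
    show "(\<lambda>i. of_nat (i + 1) * b (i + k) * cnj (a (i + l)) / (of_nat (i + l + 1) * of_nat (i + k + 1))) sums cnj S"
      using sums_cnj[THEN iffD2, OF S] by (simp add: mult_ac)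
    show "(\<Sum>j\<le>min l k. of_nat (j + 1) * b (k - j) * cnj (a (l - j)) / (of_nat (l + 1) * of_nat (k + 1))) + cnj S
      - b k * cnj (a l) / (of_nat (l + 1) * of_nat (k + 1)) = cnj R"
      unfolding R[symmetric] by (simp add: mult_ac min.commute)
  qed
qed

lemma coeff_identity_toeplitz_product:
  assumes f: "expands f a" "f \<in> L2_disk" and g: "expands g b" "g \<in> L2_disk"
  shows "coeff_identity a b k l (moment (\<lambda>w. f w * toeplitz (\<lambda>w. cnj (g w)) (\<lambda>w. w ^ k) w) l)"
proof -
  define u where "u w = cnj (g w) * w ^ k" for w
  define v where "v w = cnj (u w)" for w
  have u: "u \<in> L2_disk"
    using L2_disk_mult_monomial[OF L2_disk_cnj[OF g(2)], of k 0] by (simp add: u_def[abs_def])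
  then have v: "v \<in> L2_disk"
    unfolding v_def[abs_def] by (rule L2_disk_cnj)
  have intg: "integrable dA g" and intf: "integrable dA f"
    using f g by (simp_all add: integrable_L2_disk)
  have mom_u: "moment u j = (if j \<le> k then cnj (b (k - j)) / of_nat (k + 1) else 0)" for j
  proof -
    have "moment u j = cnj (LINT w|dA. g w * (w ^ j * cnj w ^ k))"
      unfolding moment_def by (subst Bochner_Integration.integral_cnj[symmetric]) (simp add: u_def mult_ac)
    then show ?thesis
      using expands_moment[OF g(1) intg, of j k] by simp
  qed
  have mom_v: "moment v j = b (j + k) / of_nat (j + k + 1)" for j
  proof -
    have "moment v j = (LINT w|dA. g w * (w ^ 0 * cnj w ^ (j + k)))"
      unfolding moment_def by (simp add: v_def u_def power_add mult_ac)
    then show ?thesis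
      using expands_moment[OF g(1) intg, of 0 "j + k"] by simp
  qed
  define c where "c j = of_nat (j + 1) * (cnj (b (k - j)) / of_nat (k + 1))" for j
  have Pu: "bergman_proj u w = (\<Sum>j<Suc k. c j * w ^ j)" if "w \<in> \<bbbD>" for w
  proof -
    have "(\<lambda>j. (if j < Suc k then c j else 0)) = (\<lambda>j. of_nat (j + 1) * moment u j)"
      by (auto simp: fun_eq_iff mom_u c_def)
    then have "expands (bergman_proj u) (\<lambda>j. (if j < Suc k then c j else 0))"
      using bergman_proj_expands[OF integrable_L2_disk[OF u]] by simp
    from expandsD[OF this that] expandsD[OF expands_polynomial that] show ?thesis
      by (rule sums_unique2)
  qed
  have Pv: "expands (bergman_proj v) (\<lambda>j. of_nat (j + 1) * moment v j)" "bergman_proj v \<in> L2_disk"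
    by (intro bergman_proj_expands bergman_proj_L2 integrable_L2_disk v)+
  define C where "C = bergman_proj u 0"
  have C: "C = cnj (b k) / of_nat (k + 1)"
    using bergman_proj_at_0[OF integrable_L2_disk[OF u]] by (simp add: C_def mom_u)
  let ?t1 = "\<lambda>w. \<Sum>j<Suc k. c j * (f w * (w ^ j * cnj w ^ l))"
  let ?t2 = "\<lambda>w. f w * w ^ 0 * cnj (bergman_proj v w * w ^ (0 + l))"
  let ?t3 = "\<lambda>w. C * (f w * (w ^ 0 * cnj w ^ l))"
  have int: "integrable dA (\<lambda>w. f w * (w ^ j * cnj w ^ l))" for j
    by (intro integrable_mult_monomial intf)
  have i1: "integrable dA ?t1"
    by (intro Bochner_Integration.integrable_sum integrable_mult_right int)
  have i2: "integrable dA ?t2"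
    using integrable_mult_L2_disk[OF f(2) L2_disk_cnj[OF L2_disk_mult_monomial[OF Pv(2), of l 0]]]
    by (simp add: mult_ac)
  have i3: "integrable dA ?t3"
    by (intro integrable_mult_right int)
  have "moment (\<lambda>w. f w * toeplitz (\<lambda>w. cnj (g w)) (\<lambda>w. w ^ k) w) l = (LINT w|dA. ?t1 w + ?t2 w - ?t3 w)"
    unfolding moment_def
  proof (rule Bochner_Integration.integral_cong[OF refl])
    fix w assume "w \<in> space dA"
    then have "w \<in> \<bbbD>" by simp
    have T: "toeplitz (\<lambda>w. cnj (g w)) (\<lambda>w. w ^ k) w = (\<Sum>j<Suc k. c j * w ^ j) + cnj (bergman_proj v w) - C"
      unfolding toeplitz_def harmonic_proj_def C_def Pu[OF \<open>w \<in> \<bbbD>\<close>, symmetric]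
      by (simp add: u_def[abs_def] v_def[abs_def])
    have "?t1 w = f w * (\<Sum>j<Suc k. c j * w ^ j) * cnj w ^ l"
      unfolding sum_distrib_left sum_distrib_right by (intro sum.cong refl) (simp add: mult_ac)
    then show "f w * toeplitz (\<lambda>w. cnj (g w)) (\<lambda>w. w ^ k) w * cnj w ^ l = ?t1 w + ?t2 w - ?t3 w"
      unfolding T by (simp add: algebra_simps del: sum.lessThan_Suc)
  qed
  also have "\<dots> = (LINT w|dA. ?t1 w) + (LINT w|dA. ?t2 w) - (LINT w|dA. ?t3 w)"
    using i1 i2 i3 by (simp only: Bochner_Integration.integral_diff Bochner_Integration.integral_add Bochner_Integration.integrable_add)
  also have "(LINT w|dA. ?t3 w) = a l * cnj (b k) / (of_nat (k + 1) * of_nat (l + 1))"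
    unfolding integral_mult_right_zero expands_moment[OF f(1) intf] C by simp
  also have "(LINT w|dA. ?t1 w) = (\<Sum>j\<le>min k l. of_nat (j + 1) * a (l - j) * cnj (b (k - j)) / (of_nat (k + 1) * of_nat (l + 1)))"
  proof -
    have "(LINT w|dA. ?t1 w) = (\<Sum>j<Suc k. LINT w|dA. c j * (f w * (w ^ j * cnj w ^ l)))"
      by (intro Bochner_Integration.integral_sum integrable_mult_right int)
    also have "\<dots> = (\<Sum>j<Suc k. if j \<le> l then of_nat (j + 1) * a (l - j) * cnj (b (k - j)) / (of_nat (k + 1) * of_nat (l + 1)) else 0)"
      unfolding integral_mult_right_zero expands_moment[OF f(1) intf] c_def
      by (intro sum.cong refl) (simp add: mult_ac)
    also have "\<dots> = (\<Sum>j\<le>min k l. of_nat (j + 1) * a (l - j) * cnj (b (k - j)) / (of_nat (k + 1) * of_nat (l + 1)))"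
      by (intro sum.mono_neutral_cong_right) auto
    finally show ?thesis .
  qed
  finally have R: "moment (\<lambda>w. f w * toeplitz (\<lambda>w. cnj (g w)) (\<lambda>w. w ^ k) w) l =
      (\<Sum>j\<le>min k l. of_nat (j + 1) * a (l - j) * cnj (b (k - j)) / (of_nat (k + 1) * of_nat (l + 1))) +
      (LINT w|dA. ?t2 w) - a l * cnj (b k) / (of_nat (k + 1) * of_nat (l + 1))" .
  have "(\<lambda>i. a (i + l) * cnj (of_nat (i + 1) * moment v i) / of_nat (i + 0 + l + 1)) sums (LINT w|dA. ?t2 w)"
    by (rule parseval[OF f Pv])
  also have "(\<lambda>i. a (i + l) * cnj (of_nat (i + 1) * moment v i) / of_nat (i + 0 + l + 1)) =
      (\<lambda>i. of_nat (i + 1) * a (i + l) * cnj (b (i + k)) / (of_nat (i + k + 1) * of_nat (i + l + 1)))"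
    by (simp add: mom_v fun_eq_iff mult_ac)
  finally have S: "(\<lambda>i. of_nat (i + 1) * a (i + l) * cnj (b (i + k)) / (of_nat (i + k + 1) * of_nat (i + l + 1))) sums
      (LINT w|dA. ?t2 w)" .
  show ?thesis
    unfolding coeff_identity_def
    by (rule exI[of _ "LINT w|dA. ?t2 w"]) (rule conjI[OF S R[symmetric]])
qed

text \<open>
  The coefficient of \<open>x\<^sub>j\<close> in the difference of the two moments for \<open>j \<le> k\<close>; for \<open>j > k\<close> the roles of
  \<open>J\<close> and \<open>K\<close> are exchanged. The numerator factors as
  \<open>(K + 1) (K + E + 1) - (K - J + 1) (J + K + E + 1) = J (J + E)\<close>.
\<close>

lemma hilbert_kernel_difference:
  fixes J K E :: "'a :: field"
  assumes "K + 1 \<noteq> 0" "K + E + 1 \<noteq> 0" "J + K + E + 1 \<noteq> 0"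
  shows "1 / (J + K + E + 1) - (K - J + 1) / ((K + 1) * (K + E + 1)) =
    J * (J + E) / ((K + 1) * (K + E + 1) * (J + K + E + 1))"
proof -
  have "(K + 1) * (K + E + 1) - (K - J + 1) * (J + K + E + 1) = J * (J + E)"
    by (simp add: algebra_simps)
  then show ?thesis
    using assms by (simp add: diff_frac_eq)
qed

lemma of_real_quartic:
  "complex_of_real (quartic e j) =
    of_nat j * (of_nat j + of_nat e) * ((of_nat j + 1) * (of_nat j + of_nat e + 1))"
  by (simp only: quartic_def of_real_of_nat_eq) (simp only: of_nat_mult of_nat_add of_nat_1)

text \<open>
  Equating the identity for \<open>l = k + e\<close> with Parseval's series, and multiplying by
  \<open>(k + 1) (k + e + 1)\<close>, turns the hypothesis into the linear system of the Hilbert-type matrix.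
\<close>

lemma coeff_products_vanish:
  assumes f: "expands f a" "f \<in> L2_disk" and g: "expands g b" "g \<in> L2_disk"
    and id: "\<And>k. coeff_identity a b k (k + e) (LINT w|dA. f w * w ^ k * cnj (g w * w ^ (k + e)))"
    and i: "1 \<le> i"
  shows "a (i + e) * cnj (b i) = 0"
proof -
  define x where "x j = a (j + e) * cnj (b j)" for j
  have "(\<lambda>j. of_real (quartic e (min j k) / (j + k + e + 1)) * (x j / of_nat ((j + 1) * (j + e + 1)))) sums 0" for k
  proof -
    let ?K = "of_nat (k + 1) * of_nat (k + e + 1) :: complex"
    obtain S where S: "(\<lambda>i. of_nat (i + 1) * a (i + (k + e)) * cnj (b (i + k)) / (of_nat (i + k + 1) * of_nat (i + (k + e) + 1))) sums S"
      and R: "(\<Sum>j\<le>min k (k + e). of_nat (j + 1) * a (k + e - j) * cnj (b (k - j)) / (of_nat (k + 1) * of_nat (k + e + 1))) + S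
        - a (k + e) * cnj (b k) / (of_nat (k + 1) * of_nat (k + e + 1)) = (LINT w|dA. f w * w ^ k * cnj (g w * w ^ (k + e)))"
      using id[of k] unfolding coeff_identity_def by blast
    \<comment> \<open>the three contributions to the identity, reindexed so that \<open>x\<^sub>j\<close> occurs in the \<open>j\<close>-th terms\<close>
    define t1 where "t1 j = (if j \<le> k then of_nat (k - j + 1) * x j / ?K else 0)" for j
    define t2 where "t2 j = (if k \<le> j then of_nat (j - k + 1) * x j / (of_nat (j + 1) * of_nat (j + e + 1)) else 0)" for j
    define t3 where "t3 j = (if j = k then x k / ?K else 0)" for j
    have "t1 sums (\<Sum>j\<le>k. t1 j)"
      by (rule sums_finite) (auto simp: t1_def)
    also have "(\<Sum>j\<le>k. t1 j) = (\<Sum>j\<le>min k (k + e). of_nat (j + 1) * a (k + e - j) * cnj (b (k - j)) / ?K)"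
      by (rule sum.reindex_bij_witness[where i = "\<lambda>j. k - j" and j = "\<lambda>j. k - j"])
        (auto simp: t1_def x_def add.commute)
    finally have t1: "t1 sums (\<Sum>j\<le>min k (k + e). of_nat (j + 1) * a (k + e - j) * cnj (b (k - j)) / ?K)" .
    have "(\<lambda>i. t2 (i + k)) sums S"
      using S by (simp add: t2_def x_def add_ac mult_ac)
    then have t2: "t2 sums S"
      by (subst (asm) sums_iff_shift) (simp add: t2_def)
    have t3: "t3 sums (x k / ?K)"
      unfolding t3_def using sums_single[of k "\<lambda>_. x k / ?K"] by simp
    have "(\<lambda>j. x j / of_nat (j + k + e + 1)) sums (LINT w|dA. f w * w ^ k * cnj (g w * w ^ (k + e)))"
      unfolding x_def by (rule parseval[OF f g])
    from sums_diff[OF this sums_diff[OF sums_add[OF t1 t2] t3]]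
    have "(\<lambda>j. x j / of_nat (j + k + e + 1) - (t1 j + t2 j - t3 j)) sums 0"
      using R by (simp add: x_def)
    from sums_mult[OF this, of ?K]
    have "(\<lambda>j. ?K * (x j / of_nat (j + k + e + 1) - (t1 j + t2 j - t3 j))) sums 0"
      by simp
    moreover have "?K * (x j / of_nat (j + k + e + 1) - (t1 j + t2 j - t3 j)) =
        of_real (quartic e (min j k) / (j + k + e + 1)) * (x j / of_nat ((j + 1) * (j + e + 1)))" for j
    proof -
      define J K E :: complex where JKE: "J = of_nat j" "K = of_nat k" "E = of_nat e"
      have nz: "J + 1 \<noteq> 0" "J + E + 1 \<noteq> 0" "K + 1 \<noteq> 0" "K + E + 1 \<noteq> 0" "J + K + E + 1 \<noteq> 0" "K + J + E + 1 \<noteq> 0"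
      proof -
        have "J + 1 = of_nat (j + 1)" "J + E + 1 = of_nat (j + e + 1)" "K + 1 = of_nat (k + 1)"
          "K + E + 1 = of_nat (k + e + 1)" "J + K + E + 1 = of_nat (j + k + e + 1)"
          "K + J + E + 1 = of_nat (k + j + e + 1)"
          by (simp_all add: JKE)
        then show "J + 1 \<noteq> 0" "J + E + 1 \<noteq> 0" "K + 1 \<noteq> 0" "K + E + 1 \<noteq> 0" "J + K + E + 1 \<noteq> 0" "K + J + E + 1 \<noteq> 0"
          by (simp_all only: of_nat_eq_0_iff)
      qed
      have K: "?K = (K + 1) * (K + E + 1)" and d: "of_nat (j + k + e + 1) = J + K + E + 1"
          "of_nat ((j + 1) * (j + e + 1)) = (J + 1) * (J + E + 1)"
        by (simp_all add: JKE algebra_simps)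
      show ?thesis
      proof (cases "j \<le> k")
        case True
        have "t1 j + t2 j - t3 j = (K - J + 1) / ((K + 1) * (K + E + 1)) * x j"
          using True by (auto simp: t1_def t2_def t3_def JKE of_nat_diff add_ac)
        moreover have "complex_of_real (quartic e (min j k) / (j + k + e + 1)) =
            J * (J + E) * ((J + 1) * (J + E + 1)) / (J + K + E + 1)"
          unfolding of_real_divide of_real_of_nat_eq d min_absorb1[OF True] by (simp only: of_real_quartic JKE)
        moreover have "x j / (J + K + E + 1) - (K - J + 1) / ((K + 1) * (K + E + 1)) * x j =
            (1 / (J + K + E + 1) - (K - J + 1) / ((K + 1) * (K + E + 1))) * x j"
          by (simp add: left_diff_distrib)
        ultimately show ?thesis
          unfolding K d using nz by (simp add: hilbert_kernel_difference)
      next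
        case False
        have "t1 j + t2 j - t3 j = (J - K + 1) / ((J + 1) * (J + E + 1)) * x j"
          using False by (auto simp: t1_def t2_def t3_def JKE of_nat_diff add_ac)
        moreover have "complex_of_real (quartic e (min j k) / (j + k + e + 1)) =
            K * (K + E) * ((K + 1) * (K + E + 1)) / (J + K + E + 1)"
        proof -
          have "min j k = k" using False by simp
          then show ?thesis
            unfolding of_real_divide of_real_of_nat_eq d by (simp only: of_real_quartic JKE)
        qed
        moreover have "x j / (J + K + E + 1) - (J - K + 1) / ((J + 1) * (J + E + 1)) * x j =
            (1 / (J + K + E + 1) - (J - K + 1) / ((J + 1) * (J + E + 1))) * x j"
          by (simp add: left_diff_distrib)
        moreover have "1 / (J + K + E + 1) - (J - K + 1) / ((J + 1) * (J + E + 1)) =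
            K * (K + E) / ((J + 1) * (J + E + 1) * (J + K + E + 1))"
          using hilbert_kernel_difference[of J E K] nz by (simp only: add.commute[of K J])
        ultimately show ?thesis
          unfolding K d using nz by (simp add: mult_ac)
      qed
    qed
    ultimately show ?thesis by (simp only:)
  qed
  moreover have "summable (\<lambda>j. cmod (x j) / (j + e + 1))"
    unfolding x_def by (rule coeffs_product_summable[OF f g])
  ultimately have "x i = 0"
    using i by (intro hilbert_min_kernel_injective[where x = x and e = e]) auto
  then show ?thesis by (simp add: x_def)
qed

text \<open>
  The monomials \<open>z\<^sup>k\<close> and the moments against \<open>cnj z\<^sup>l\<close> already give equations for every pair
  \<open>(m, n)\<close>: the case \<open>m \<ge> n\<close> uses \<open>l \<ge> k\<close>, and the case \<open>m < n\<close> uses \<open>l < k\<close>, after exchanging the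
  roles of \<open>f\<close> and \<open>g\<close>.
\<close>

lemma toeplitz_commute_imp_constant:
  assumes f: "expands f a" "f \<in> L2_disk" and g: "expands g b" "g \<in> L2_disk"
    and comm: "\<And>p z. p \<in> harmonic_polynomials \<Longrightarrow> z \<in> \<bbbD> \<Longrightarrow>
      toeplitz f (toeplitz (\<lambda>w. cnj (g w)) p) z = toeplitz (\<lambda>w. cnj (g w)) (toeplitz f p) z"
  shows "f constant_on \<bbbD> \<or> g constant_on \<bbbD>"
proof -
  have id: "coeff_identity a b k l (LINT w|dA. f w * w ^ k * cnj (g w * w ^ l))" for k l
  proof -
    define p :: "complex \<Rightarrow> complex" where "p w = w ^ k" for w
    have p: "p \<in> harmonic_polynomials"
      unfolding harmonic_polynomials_def
    proof (intro CollectI exI conjI)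
      show "p = (\<lambda>z. \<Sum>i\<le>k. (if i = k then 1 else 0) * z ^ i + 0 * cnj z ^ i)"
        by (simp add: p_def fun_eq_iff if_distrib[of "\<lambda>x. x * _"] cong: if_cong)
    qed simp
    let ?u = "\<lambda>w. f w * toeplitz (\<lambda>w. cnj (g w)) p w" and ?v = "\<lambda>w. cnj (g w) * toeplitz f p w"
    have fp: "toeplitz f p w = f w * w ^ k" if "w \<in> \<bbbD>" for w
    proof -
      have "(\<lambda>w. f w * p w) \<in> harmonic_bergman"
      proof (rule harmonic_bergmanI)
        show "expands (\<lambda>w. f w * p w) (\<lambda>n. if n < k then 0 else a (n - k))"
          unfolding expands_def
        proof
          fix w assume "w \<in> \<bbbD>"
          then have "(\<lambda>n. a n * w ^ n * w ^ k) sums (f w * w ^ k)"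
            by (intro sums_mult2 expandsD[OF f(1)])
          then have "(\<lambda>n. (if n + k < k then 0 else a (n + k - k)) * w ^ (n + k)) sums (f w * w ^ k)"
            by (simp add: power_add mult_ac)
          then show "(\<lambda>n. (if n < k then 0 else a (n - k)) * w ^ n) sums (f w * p w)"
            by (subst (asm) sums_iff_shift) (simp add: p_def)
        qed
        show "(\<lambda>w. f w * p w) \<in> L2_disk"
          by (rule L2_disk_mult_harmonic_polynomial[OF f(2) p])
        show "expands (\<lambda>_. 0) (\<lambda>_. 0)" by (simp add: expands_def)
      qed (simp_all add: L2_disk_const)
      from harmonic_proj_fixes[OF this that] show ?thesis
        by (simp add: toeplitz_def p_def)
    qed
    have gp: "(\<lambda>w. cnj (g w) * p w) \<in> L2_disk"
      by (rule L2_disk_mult_harmonic_polynomial[OF L2_disk_cnj[OF g(2)] p])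
    have "integrable dA ?u"
      unfolding toeplitz_def
      by (intro integrable_mult_L2_disk f harmonic_bergman_L2 harmonic_proj_mem gp)
    moreover have "integrable dA ?v"
      unfolding toeplitz_def
      by (intro integrable_mult_L2_disk L2_disk_cnj g harmonic_bergman_L2 harmonic_proj_mem
          L2_disk_mult_harmonic_polynomial f p)
    moreover have "harmonic_proj ?u z = harmonic_proj ?v z" if "z \<in> \<bbbD>" for z
      using comm[OF p that] by (simp only: toeplitz_def)
    ultimately have "moment ?u l = moment ?v l"
      by (rule moment_eq_if_harmonic_proj_eq)
    also have "moment ?v l = (LINT w|dA. f w * w ^ k * cnj (g w * w ^ l))"
      unfolding moment_def by (rule Bochner_Integration.integral_cong) (simp_all add: fp)
    finally show ?thesis
      using coeff_identity_toeplitz_product[OF f g, of k l] by (simp add: p_def[abs_def])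
  qed
  have id': "coeff_identity b a k l (LINT w|dA. g w * w ^ k * cnj (f w * w ^ l))" for k l
  proof -
    have "cnj (LINT w|dA. f w * w ^ l * cnj (g w * w ^ k)) = (LINT w|dA. g w * w ^ k * cnj (f w * w ^ l))"
      by (subst Bochner_Integration.integral_cnj[symmetric]) (simp add: mult_ac)
    then show ?thesis
      using coeff_identity_swap[OF id[of l k]] by simp
  qed
  have "a m = 0 \<or> b n = 0" if "1 \<le> m" "1 \<le> n" for m n
  proof (cases "n \<le> m")
    case True
    then have "a (n + (m - n)) * cnj (b n) = 0"
      by (intro coeff_products_vanish[OF f g id] that)
    with True show ?thesis by simp
  next
    case False
    then have "b (m + (n - m)) * cnj (a m) = 0"
      by (intro coeff_products_vanish[OF g f id'] that)
    with False show ?thesis by auto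
  qed
  then have "(\<forall>n\<ge>1. a n = 0) \<or> (\<forall>n\<ge>1. b n = 0)"
    by blast
  then show ?thesis
    using constant_on_disk[OF f(1)] constant_on_disk[OF g(1)] by blast
qed

theorem theorem1p1:
  fixes f g :: "complex \<Rightarrow> complex"
  assumes "f \<in> bergman_space" and "g \<in> bergman_space"
  shows "(\<forall>p \<in> harmonic_polynomials. \<forall>z \<in> \<bbbD>.
            toeplitz f (toeplitz (\<lambda>w. cnj (g w)) p) z =
            toeplitz (\<lambda>w. cnj (g w)) (toeplitz f p) z)
         \<longleftrightarrow> f constant_on \<bbbD> \<or> g constant_on \<bbbD>"
proof -
  obtain a where f: "expands f a" "f \<in> L2_disk"
    using bergman_space_expands[OF assms(1)] .
  obtain b where g: "expands g b" "g \<in> L2_disk"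
    using bergman_space_expands[OF assms(2)] .
  show ?thesis
  proof
    assume "\<forall>p \<in> harmonic_polynomials. \<forall>z \<in> \<bbbD>.
      toeplitz f (toeplitz (\<lambda>w. cnj (g w)) p) z = toeplitz (\<lambda>w. cnj (g w)) (toeplitz f p) z"
    then show "f constant_on \<bbbD> \<or> g constant_on \<bbbD>"
      by (intro toeplitz_commute_imp_constant[OF f g]) simp
  next
    assume "f constant_on \<bbbD> \<or> g constant_on \<bbbD>"
    then show "\<forall>p \<in> harmonic_polynomials. \<forall>z \<in> \<bbbD>.
      toeplitz f (toeplitz (\<lambda>w. cnj (g w)) p) z = toeplitz (\<lambda>w. cnj (g w)) (toeplitz f p) z"
    proof
      assume "f constant_on \<bbbD>"
      then obtain c where "\<And>w. w \<in> \<bbbD> \<Longrightarrow> f w = c"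
        unfolding constant_on_def by blast
      then show ?thesis
        by (intro ballI toeplitz_constant_commutes L2_disk_cnj g)
    next
      assume "g constant_on \<bbbD>"
      then obtain c where "\<And>w. w \<in> \<bbbD> \<Longrightarrow> g w = c"
        unfolding constant_on_def by blast
      then have "\<And>w. w \<in> \<bbbD> \<Longrightarrow> cnj (g w) = cnj c"
        by simp
      then show ?thesis
        by (intro ballI sym[OF toeplitz_constant_commutes] f)
    qed
  qed
qed

end
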